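(* There exists a sequence of finite irreducible lazy reversible Markov chains which exhibits total-variation cutoff and exhibits only pre-cutoff with pre-cutoff ratio equal to $2$ in separation. Vice versa, there exists a sequence of finite irreducible lazy reversible Markov chains which exhibits separation cutoff and exhibits only pre-cutoff with pre-cutoff ratio equal to $2$ in total variation.
   Context: All chains are discrete-time, irreducible, on a finite state space $\Omega$, with transition matrix $P$ and stationary distribution $\pi$. Reversible: $\pi(x)P(x,y)=\pi(y)P(y,x)$ for all $x,y$. Lazy: $P(x,x)\ge1/2$ for all $x$. Total variation: $\|\mu-\nu\|_{\mathrm{TV}}=\frac12\sum_x|\mu(x)-\nu(x)|$, $d(t)=\max_{x}\|P^t(x,\cdot)-\pi\|_{\mathrm{TV}}$, $t_{\mathrm{mix}}(\varepsilon)=\inf\{t: d(t)\le\varepsilon\}$. Separation: $d_{\mathrm{sep}}(t)=1-\min_{x,y\in\Omega}P^t(x,y)/\pi(y)$, $t_{\mathrm{sep}}(\varepsilon)=\inf\{t:d_{\mathrm{sep}}(t)\le\varepsilon\}$. A superscript $(n)$ denotes the quantity for the $n$-th chain of a sequence. The sequence exhibits total-variation (resp. separation) cutoff if for all $\varepsilon\in(0,1/2]$, $\lim_{n\to\infty}t_{\mathrm{mix}}^{(n)}(\varepsilon)/t_{\mathrm{mix}}^{(n)}(1-\varepsilon)=1$ (resp. the same with $t_{\mathrm{sep}}^{(n)}$). It exhibits pre-cutoff in total variation (resp. separation) if $\sup_{0<\varepsilon<1/2}\limsup_{n\to\infty}t_{\mathrm{mix}}^{(n)}(\varepsilon)/t_{\mathrm{mix}}^{(n)}(1-\varepsilon)<\infty$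 (resp. $\sup_{0<\varepsilon<1/2}\limsup_{n\to\infty}t_{\mathrm{sep}}^{(n)}(\varepsilon)/t_{\mathrm{sep}}^{(n)}(1-\varepsilon)<\infty$); the value of this supremum is called the pre-cutoff ratio. *)

theory Defs
  imports "HOL-Analysis.Analysis"
begin

text \<open>A chain carries its state space as a set, so that the chains of a sequence may have
  different state spaces.  The values of the functions below outside \<open>states\<close> are irrelevant.\<close>

record 'a chain =
  states :: "'a set"
  prob :: "'a \<Rightarrow> 'a \<Rightarrow> real"
  stationary :: "'a \<Rightarrow> real"

definition stochastic_matrix :: "'a set \<Rightarrow> ('a \<Rightarrow> 'a \<Rightarrow> real) \<Rightarrow> bool" where
  "stochastic_matrix \<Omega> P \<longleftrightarrow>
     (\<forall>x\<in>\<Omega>. \<forall>y\<in>\<Omega>. 0 \<le> P x y) \<and> (\<forall>x\<in>\<Omega>. (\<Sum>y\<in>\<Omega>. P x y) = 1)"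

definition stationary_distribution ::
    "'a set \<Rightarrow> ('a \<Rightarrow> 'a \<Rightarrow> real) \<Rightarrow> ('a \<Rightarrow> real) \<Rightarrow> bool" where
  "stationary_distribution \<Omega> P \<pi> \<longleftrightarrow>
     (\<forall>x\<in>\<Omega>. 0 \<le> \<pi> x) \<and> (\<Sum>x\<in>\<Omega>. \<pi> x) = 1 \<and>
     (\<forall>y\<in>\<Omega>. (\<Sum>x\<in>\<Omega>. \<pi> x * P x y) = \<pi> y)"

definition finite_markov_chain :: "'a chain \<Rightarrow> bool" where
  "finite_markov_chain C \<longleftrightarrow>
     finite (states C) \<and> states C \<noteq> {} \<and>
     stochastic_matrix (states C) (prob C) \<and>
     stationary_distribution (states C) (prob C) (stationary C)"

primrec step_prob :: "'a chain \<Rightarrow> nat \<Rightarrow> 'a \<Rightarrow> 'a \<Rightarrow> real" where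
  "step_prob C 0 x y = (if x = y then 1 else 0)"
| "step_prob C (Suc t) x y = (\<Sum>z\<in>states C. prob C x z * step_prob C t z y)"

definition irreducible_chain :: "'a chain \<Rightarrow> bool" where
  "irreducible_chain C \<longleftrightarrow> (\<forall>x\<in>states C. \<forall>y\<in>states C. \<exists>t. step_prob C t x y > 0)"

definition reversible_chain :: "'a chain \<Rightarrow> bool" where
  "reversible_chain C \<longleftrightarrow>
     (\<forall>x\<in>states C. \<forall>y\<in>states C.
        stationary C x * prob C x y = stationary C y * prob C y x)"

definition lazy_chain :: "'a chain \<Rightarrow> bool" where
  "lazy_chain C \<longleftrightarrow> (\<forall>x\<in>states C. prob C x x \<ge> 1 / 2)"

definition tv_norm :: "'a set \<Rightarrow> ('a \<Rightarrow> real) \<Rightarrow> ('a \<Rightarrow> real) \<Rightarrow> real" where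
  "tv_norm \<Omega> \<mu> \<nu> = 1 / 2 * (\<Sum>x\<in>\<Omega>. \<bar>\<mu> x - \<nu> x\<bar>)"

definition d_tv :: "'a chain \<Rightarrow> nat \<Rightarrow> real" where
  "d_tv C t = (MAX x\<in>states C. tv_norm (states C) (step_prob C t x) (stationary C))"

definition d_sep :: "'a chain \<Rightarrow> nat \<Rightarrow> real" where
  "d_sep C t =
     1 - (MIN (x, y)\<in>states C \<times> states C. step_prob C t x y / stationary C y)"

text \<open>On \<open>nat\<close>, \<open>Inf {} = 0\<close>; for an irreducible lazy chain and \<open>\<epsilon> > 0\<close> the sets below
  are nonempty, by convergence to equilibrium.\<close>

definition t_mix :: "'a chain \<Rightarrow> real \<Rightarrow> nat" where
  "t_mix C \<epsilon> = Inf {t. d_tv C t \<le> \<epsilon>}"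

definition t_sep :: "'a chain \<Rightarrow> real \<Rightarrow> nat" where
  "t_sep C \<epsilon> = Inf {t. d_sep C t \<le> \<epsilon>}"

text \<open>The parameter \<open>T\<close> below is \<open>t_mix\<close> or \<open>t_sep\<close>.  The quotient is taken in \<open>ereal\<close>, where
  \<open>a / 0 = \<infinity>\<close> for \<open>a > 0\<close>, so that a vanishing denominator cannot make the ratio small.
  The remaining case \<open>0 / 0 = 0\<close> requires, for \<open>\<epsilon> < 1/2\<close>, a chain with a single state.\<close>

definition time_ratio :: "('a chain \<Rightarrow> real \<Rightarrow> nat) \<Rightarrow> 'a chain \<Rightarrow> real \<Rightarrow> ereal" where
  "time_ratio T C \<epsilon> = ereal (real (T C \<epsilon>)) / ereal (real (T C (1 - \<epsilon>)))"

definition cutoff :: "('a chain \<Rightarrow> real \<Rightarrow> nat) \<Rightarrow> (nat \<Rightarrow> 'a chain) \<Rightarrow> bool" where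
  "cutoff T C \<longleftrightarrow> (\<forall>\<epsilon>\<in>{0<..1/2}. (\<lambda>n. time_ratio T (C n) \<epsilon>) \<longlonglongrightarrow> 1)"

definition pre_cutoff_ratio ::
    "('a chain \<Rightarrow> real \<Rightarrow> nat) \<Rightarrow> (nat \<Rightarrow> 'a chain) \<Rightarrow> ereal" where
  "pre_cutoff_ratio T C = (SUP \<epsilon>\<in>{0<..<1/2}. limsup (\<lambda>n. time_ratio T (C n) \<epsilon>))"

definition pre_cutoff :: "('a chain \<Rightarrow> real \<Rightarrow> nat) \<Rightarrow> (nat \<Rightarrow> 'a chain) \<Rightarrow> bool" where
  "pre_cutoff T C \<longleftrightarrow> pre_cutoff_ratio T C < \<infinity>"

definition lazy_reversible_sequence :: "(nat \<Rightarrow> 'a chain) \<Rightarrow> bool" where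
  "lazy_reversible_sequence C \<longleftrightarrow>
     (\<forall>n. finite_markov_chain (C n) \<and> irreducible_chain (C n) \<and>
          lazy_chain (C n) \<and> reversible_chain (C n))"

end

theory Submission
  imports Defs "HOL-Real_Asymp.Real_Asymp"
begin

text \<open>The chains consist of legs of length \<open>L\<close> joined at a centre that carries almost all of the
  stationary mass, with a lazy drift of speed \<open>1/4\<close> towards the centre.  Total variation distance
  from \<open>x\<close> is the probability of not having reached the centre yet.  By reversibility,
  \<open>P\<^sup>t(x,y) / \<pi>(y)\<close> is of order one only if \<open>t\<close> exceeds the sum of the travel times of \<open>x\<close> and \<open>y\<close>
  to the centre, unless one of the two states lies on the way of the other; in the latter case it
  is huge, because \<open>\<pi>\<close> is minute off the centre.

  First sequence: two legs, one of which is left for the centre at rate \<open>1/(4L)\<close> from every state.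
  Worst-case travel times concentrate at \<open>T = 4L\<close>.  For the leaves \<open>x\<close>, \<open>y\<close> of the two legs and
  \<open>0 < u < 1\<close>, the separation at time \<open>(1 + u) T\<close> is about \<open>exp (- u)\<close>, the probability that no
  jump occurs before time \<open>u T\<close>; from time \<open>2 T\<close> on it vanishes.

  Second sequence: two plain legs, and an extension of one of them from which the chain jumps
  to the leaf of the other at rate \<open>1/(4L)\<close>.  The leaves of the plain legs force the
  separation time to be \<open>2 T\<close>, whereas the total variation distance decays like \<open>exp (- u)\<close> between
  \<open>T\<close> and \<open>2 T\<close>: the whole extension is crossed with probability bounded below, but from any of
  its states a jump within time \<open>u T\<close> has probability at least about \<open>1 - exp (- u)\<close>.\<close>

section \<open>Finite reversible chains\<close>

text \<open>Off \<open>c\<close> the difference is at most \<open>\<mu> x + \<nu> x\<close>, which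
  sums to the bound; the term at \<open>c\<close> obeys the same bound, and the factor 1/2 absorbs
  the doubling.\<close>

lemma tv_norm_le_point:
  assumes "finite \<Omega>" "c \<in> \<Omega>" "\<And>x. x \<in> \<Omega> \<Longrightarrow> 0 \<le> \<mu> x" "\<And>x. x \<in> \<Omega> \<Longrightarrow> 0 \<le> \<nu> x"
    and "sum \<mu> \<Omega> = 1" "sum \<nu> \<Omega> = 1"
  shows "tv_norm \<Omega> \<mu> \<nu> \<le> (1 - \<mu> c) + (1 - \<nu> c)"
proof -
  have "(\<Sum>x\<in>\<Omega>-{c}. \<bar>\<mu> x - \<nu> x\<bar>) \<le> (\<Sum>x\<in>\<Omega>-{c}. \<mu> x + \<nu> x)"
    by (intro sum_mono) (use assms(3,4) in force)
  also have "\<dots> = (1 - \<mu> c) + (1 - \<nu> c)"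
    using assms by (simp add: sum.distrib sum_diff1)
  finally have *: "(\<Sum>x\<in>\<Omega>-{c}. \<bar>\<mu> x - \<nu> x\<bar>) \<le> (1 - \<mu> c) + (1 - \<nu> c)" .
  have "\<mu> c \<le> 1" "\<nu> c \<le> 1"
    using member_le_sum[of c \<Omega> \<mu>] member_le_sum[of c \<Omega> \<nu>] assms by auto
  then have "\<bar>\<mu> c - \<nu> c\<bar> \<le> (1 - \<mu> c) + (1 - \<nu> c)" by linarith
  with * show ?thesis
    using assms(1,2) by (simp add: tv_norm_def sum.remove[of \<Omega> c])
qed

text \<open>The total masses agree, so what \<open>\<mu>\<close> lacks at \<open>c\<close> is
  surplus elsewhere: the deficit counts twice, which cancels the factor 1/2.\<close>

lemma tv_norm_ge_point:
  assumes "finite \<Omega>" "c \<in> \<Omega>" "sum \<mu> \<Omega> = 1" "sum \<nu> \<Omega> = 1"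
  shows "\<nu> c - \<mu> c \<le> tv_norm \<Omega> \<mu> \<nu>"
proof -
  have "\<nu> c - \<mu> c = (\<Sum>x\<in>\<Omega>-{c}. \<mu> x - \<nu> x)"
    using assms by (simp add: sum_subtractf sum_diff1)
  also have "\<dots> \<le> (\<Sum>x\<in>\<Omega>-{c}. \<bar>\<mu> x - \<nu> x\<bar>)"
    by (intro sum_mono) auto
  finally show ?thesis
    using assms(1,2) by (simp add: tv_norm_def sum.remove[of \<Omega> c])
qed

section \<open>Transition probabilities and densities of a reversible chain\<close>

locale reversible_markov =
  fixes C :: "'a chain"
  assumes markov: "finite_markov_chain C"
    and reversible: "reversible_chain C"
    and stationary_pos: "\<And>x. x \<in> states C \<Longrightarrow> 0 < stationary C x"
begin

lemma finite_states: "finite (states C)"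
  and states_ne: "states C \<noteq> {}"
  and prob_nonneg: "\<lbrakk>x \<in> states C; y \<in> states C\<rbrakk> \<Longrightarrow> 0 \<le> prob C x y"
  and prob_sum: "x \<in> states C \<Longrightarrow> (\<Sum>y\<in>states C. prob C x y) = 1"
  and stationary_sum: "sum (stationary C) (states C) = 1"
  using markov
  by (auto simp: finite_markov_chain_def stochastic_matrix_def stationary_distribution_def)

lemma step_nonneg: "\<lbrakk>x \<in> states C; y \<in> states C\<rbrakk> \<Longrightarrow> 0 \<le> step_prob C t x y"
  by (induction t arbitrary: x) (auto intro!: sum_nonneg mult_nonneg_nonneg prob_nonneg)

lemma step_sum: "x \<in> states C \<Longrightarrow> (\<Sum>y\<in>states C. step_prob C t x y) = 1"
proof (induction t arbitrary: x)
  case 0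
  then show ?case using finite_states by simp
next
  case (Suc t)
  have "(\<Sum>y\<in>states C. step_prob C (Suc t) x y)
      = (\<Sum>z\<in>states C. prob C x z * (\<Sum>y\<in>states C. step_prob C t z y))"
    by (simp add: sum_distrib_left) (rule sum.swap)
  then show ?case using Suc prob_sum by simp
qed

lemma step_sum_le_1:
  assumes "x \<in> states C" "A \<subseteq> states C"
  shows "(\<Sum>y\<in>A. step_prob C t x y) \<le> 1"
  using sum_mono2[OF finite_states assms(2), of "step_prob C t x"] step_nonneg assms
  by (auto simp: step_sum)

lemma step_le_1: "\<lbrakk>x \<in> states C; y \<in> states C\<rbrakk> \<Longrightarrow> step_prob C t x y \<le> 1"
  using step_sum_le_1[of x "{y}"] by simp

lemma step_add:
  assumes "x \<in> states C"
  shows "step_prob C (s + t) x y = (\<Sum>z\<in>states C. step_prob C s x z * step_prob C t z y)"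
  using assms
proof (induction s arbitrary: x)
  case 0
  have "(\<Sum>z\<in>states C. step_prob C 0 x z * step_prob C t z y)
      = (\<Sum>z\<in>states C. if x = z then step_prob C t z y else 0)"
    by (intro sum.cong) auto
  then show ?case using 0 finite_states by simp
next
  case (Suc s)
  have "step_prob C (Suc s + t) x y
      = (\<Sum>w\<in>states C. \<Sum>z\<in>states C. prob C x w * step_prob C s w z * step_prob C t z y)"
    using Suc.IH by (simp add: sum_distrib_left mult.assoc)
  also have "\<dots> = (\<Sum>z\<in>states C. \<Sum>w\<in>states C. prob C x w * step_prob C s w z * step_prob C t z y)"
    by (rule sum.swap)
  finally show ?case by (simp add: sum_distrib_right)
qed

lemma step_add_ge:
  assumes "x \<in> states C" "y \<in> states C" "z \<in> states C"
  shows "step_prob C s x z * step_prob C t z y \<le> step_prob C (s + t) x y"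
  unfolding step_add[OF assms(1)]
  using assms finite_states by (intro member_le_sum) (auto intro!: mult_nonneg_nonneg step_nonneg)

lemma step_Suc_ge:
  assumes "x \<in> states C" "y \<in> states C" "z \<in> states C"
  shows "prob C x z * step_prob C t z y \<le> step_prob C (Suc t) x y"
  unfolding step_prob.simps
  using assms finite_states
  by (intro member_le_sum) (auto intro!: mult_nonneg_nonneg step_nonneg prob_nonneg)

lemma step_reversible:
  assumes "x \<in> states C" "y \<in> states C"
  shows "stationary C x * step_prob C t x y = stationary C y * step_prob C t y x"
  using assms
proof (induction t arbitrary: x y)
  case 0
  then show ?case by auto
next
  case (Suc t)
  have "stationary C x * step_prob C (Suc t) x y
      = (\<Sum>z\<in>states C. (stationary C x * prob C x z) * step_prob C t z y)"
    by (simp add: sum_distrib_left mult.assoc)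
  also have "\<dots> = (\<Sum>z\<in>states C. (stationary C z * step_prob C t z y) * prob C z x)"
    using reversible Suc.prems by (intro sum.cong) (auto simp: reversible_chain_def)
  also have "\<dots> = (\<Sum>z\<in>states C. stationary C y * (step_prob C t y z * prob C z x))"
    using Suc.IH Suc.prems by (intro sum.cong) auto
  \<comment> \<open>\<open>step_prob\<close> peels off the first step, but reversal has put the
    single step last; \<open>step_add\<close> with a second block of length 1 joins the two
    forms.\<close>
  also have "\<dots> = stationary C y * step_prob C (t + 1) y x"
    using Suc.prems finite_states
    by (subst step_add) (auto simp: sum_distrib_left if_distrib cong: if_cong)
  finally show ?case by simp
qed

text \<open>The density with respect to the stationary distribution, whose minimum enters the
  separation distance; by reversibility it is symmetric.\<close>

definition dens :: "nat \<Rightarrow> 'a \<Rightarrow> 'a \<Rightarrow> real" where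
  "dens t x y = step_prob C t x y / stationary C y"

lemma dens_sym: "\<lbrakk>x \<in> states C; y \<in> states C\<rbrakk> \<Longrightarrow> dens t x y = dens t y x"
  using step_reversible[of x y t] stationary_pos[of x] stationary_pos[of y]
  by (simp add: dens_def field_simps)

lemma dens_nonneg: "\<lbrakk>x \<in> states C; y \<in> states C\<rbrakk> \<Longrightarrow> 0 \<le> dens t x y"
  by (simp add: dens_def step_nonneg stationary_pos less_imp_le)

lemma dens_add:
  assumes "x \<in> states C"
  shows "dens (s + t) x y = (\<Sum>z\<in>states C. step_prob C s x z * dens t z y)"
  using assms by (simp add: dens_def step_add sum_divide_distrib)

lemma dens_add_ge:
  assumes "x \<in> states C" "y \<in> states C" "A \<subseteq> states C" "0 \<le> d"
    and "\<And>z. z \<in> A \<Longrightarrow> d \<le> dens t z y"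
  shows "(\<Sum>z\<in>A. step_prob C s x z) * d \<le> dens (s + t) x y"
proof -
  have "(\<Sum>z\<in>A. step_prob C s x z) * d \<le> (\<Sum>z\<in>A. step_prob C s x z * dens t z y)"
    unfolding sum_distrib_right
    using assms by (intro sum_mono mult_left_mono step_nonneg) auto
  also have "\<dots> \<le> dens (s + t) x y"
    unfolding dens_add[OF assms(1)] using assms finite_states
    by (intro sum_mono2) (auto intro!: mult_nonneg_nonneg step_nonneg dens_nonneg)
  finally show ?thesis .
qed

lemma stationary_le_1: "x \<in> states C \<Longrightarrow> stationary C x \<le> 1"
  using member_le_sum[of x "states C" "stationary C"] stationary_sum finite_states
    stationary_pos by force

lemma step_le_dens: "\<lbrakk>x \<in> states C; y \<in> states C\<rbrakk> \<Longrightarrow> step_prob C t x y \<le> dens t x y"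
  unfolding dens_def
  using mult_left_mono[OF stationary_le_1[of y] step_nonneg[of x y t]] stationary_pos[of y]
  by (simp add: field_simps)

text \<open>Symmetry of the density turns the last \<open>t\<close> steps, from \<open>c\<close> to
  \<open>y\<close>, into a run from \<open>y\<close> to \<open>c\<close>. This is why twice the
  travel time to the centre suffices for separation.\<close>

lemma dens_through_point:
  assumes "x \<in> states C" "y \<in> states C" "c \<in> states C"
  shows "step_prob C s x c * step_prob C t y c \<le> dens (s + t) x y"
proof -
  have "step_prob C s x c * step_prob C t y c \<le> step_prob C s x c * dens t y c"
    using assms by (intro mult_left_mono step_le_dens step_nonneg) auto
  also have "\<dots> \<le> dens (s + t) x y"
    using dens_add_ge[of x y "{c}" "dens t y c" t s] assms dens_sym[of y c t] dens_nonneg by simp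
  finally show ?thesis .
qed

text \<open>Meant for a state \<open>c\<close> that carries almost all stationary mass, so that the
  distance is governed by the probability of not being at \<open>c\<close>.\<close>

lemma d_tv_le:
  assumes "c \<in> states C" "\<And>x. x \<in> states C \<Longrightarrow> 1 - step_prob C t x c \<le> d"
  shows "d_tv C t \<le> d + (1 - stationary C c)"
  unfolding d_tv_def
proof (rule Max.boundedI)
  fix v assume "v \<in> (\<lambda>x. tv_norm (states C) (step_prob C t x) (stationary C)) ` states C"
  then obtain x where x: "x \<in> states C" "v = tv_norm (states C) (step_prob C t x) (stationary C)"
    by auto
  have "v \<le> (1 - step_prob C t x c) + (1 - stationary C c)"
    unfolding x(2) using x(1) assms(1) finite_states step_nonneg stationary_pos
    by (intro tv_norm_le_point) (auto simp: step_sum stationary_sum less_imp_le)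
  with assms(2)[OF x(1)] show "v \<le> d + (1 - stationary C c)" by linarith
qed (use finite_states states_ne in auto)

lemma d_tv_ge:
  assumes "c \<in> states C" "x \<in> states C"
  shows "stationary C c - step_prob C t x c \<le> d_tv C t"
proof -
  have "stationary C c - step_prob C t x c
      \<le> tv_norm (states C) (step_prob C t x) (stationary C)"
    using assms finite_states by (intro tv_norm_ge_point) (auto simp: step_sum stationary_sum)
  also have "\<dots> \<le> d_tv C t"
    unfolding d_tv_def using assms finite_states by (intro Max_ge) auto
  finally show ?thesis .
qed

lemma d_sep_le:
  assumes "\<And>x y. \<lbrakk>x \<in> states C; y \<in> states C\<rbrakk> \<Longrightarrow> 1 - d \<le> dens t x y"
  shows "d_sep C t \<le> d"
proof -
  have "1 - d \<le> (MIN (x, y)\<in>states C \<times> states C. step_prob C t x y / stationary C y)"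
    using finite_states states_ne assms by (subst Min_ge_iff) (auto simp: dens_def)
  then show ?thesis by (simp add: d_sep_def)
qed

lemma d_sep_ge:
  assumes "x \<in> states C" "y \<in> states C"
  shows "1 - dens t x y \<le> d_sep C t"
proof -
  have "(MIN (x, y)\<in>states C \<times> states C. step_prob C t x y / stationary C y) \<le> dens t x y"
    using finite_states assms by (intro Min_le) (auto simp: dens_def image_iff intro!: bexI[of _ "(x,y)"])
  then show ?thesis by (simp add: d_sep_def)
qed

end

section \<open>From distance profiles to cutoff\<close>

lemma Inf_level_le:
  fixes D :: "nat \<Rightarrow> real"
  assumes "\<exists>t. real t \<le> a \<and> D t \<le> \<epsilon>"
  shows "real (Inf {t. D t \<le> \<epsilon>}) \<le> a"
proof -
  from assms obtain t where t: "real t \<le> a" "D t \<le> \<epsilon>" by blast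
  from t(2) have "Inf {t. D t \<le> \<epsilon>} \<le> t" by (intro cInf_lower) auto
  with t(1) show ?thesis by linarith
qed

text \<open>The first hypothesis excludes the default value \<open>Inf {} = 0\<close>.\<close>

lemma Inf_level_gt:
  fixes D :: "nat \<Rightarrow> real"
  assumes "\<exists>t. D t \<le> \<epsilon>" "\<forall>t. real t \<le> a \<longrightarrow> \<epsilon> < D t"
  shows "a < real (Inf {t. D t \<le> \<epsilon>})"
proof -
  have "Inf {t. D t \<le> \<epsilon>} \<in> {t. D t \<le> \<epsilon>}" using assms(1) by (intro Inf_nat_def1) auto
  then show ?thesis using assms(2) by (metis mem_Collect_eq not_le)
qed

text \<open>Treats \<open>t_mix\<close> with \<open>d_tv\<close> and \<open>t_sep\<close> with
  \<open>d_sep\<close> alike; \<open>\<tau> n\<close> is the time unit for the chain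
  \<open>C n\<close>.\<close>

locale distance_profile =
  fixes T :: "'a chain \<Rightarrow> real \<Rightarrow> nat" and D :: "'a chain \<Rightarrow> nat \<Rightarrow> real"
    and C :: "nat \<Rightarrow> 'a chain" and \<tau> :: "nat \<Rightarrow> real"
  assumes T_Inf: "\<And>C \<epsilon>. T C \<epsilon> = Inf {t. D C t \<le> \<epsilon>}"
    and scale_pos: "\<And>n. 0 < \<tau> n"
begin

text \<open>An upper bound on the first time below a level needs one good time, whereas the lower
  bound in \<open>above_until\<close> needs all earlier times to be bad.\<close>

definition below_at :: "real \<Rightarrow> real \<Rightarrow> bool" where
  "below_at a \<epsilon> \<longleftrightarrow> (\<forall>\<^sub>F n in sequentially. \<exists>t. real t \<le> a * \<tau> n \<and> D (C n) t \<le> \<epsilon>)"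

definition above_until :: "real \<Rightarrow> real \<Rightarrow> bool" where
  "above_until a \<epsilon> \<longleftrightarrow> (\<forall>\<^sub>F n in sequentially. \<forall>t. real t \<le> a * \<tau> n \<longrightarrow> \<epsilon> < D (C n) t)"

lemma below_at_le: "below_at a \<epsilon> \<Longrightarrow> \<epsilon> \<le> \<epsilon>' \<Longrightarrow> below_at a \<epsilon>'"
  unfolding below_at_def by (elim eventually_mono) (meson order_trans)

lemma above_until_ge: "above_until a \<epsilon> \<Longrightarrow> \<epsilon>' \<le> \<epsilon> \<Longrightarrow> above_until a \<epsilon>'"
  unfolding above_until_def by (elim eventually_mono) (meson order_le_less_trans)

lemma time_le: "below_at a \<epsilon> \<Longrightarrow> \<forall>\<^sub>F n in sequentially. real (T (C n) \<epsilon>) \<le> a * \<tau> n"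
  unfolding below_at_def T_Inf by (elim eventually_mono) (rule Inf_level_le)

lemma time_gt:
  assumes "above_until a \<epsilon>" "below_at b \<epsilon>"
  shows "\<forall>\<^sub>F n in sequentially. a * \<tau> n < real (T (C n) \<epsilon>)"
  using assms unfolding above_until_def below_at_def T_Inf
  by eventually_elim (intro Inf_level_gt; blast)

lemma ratio_le:
  assumes "below_at a \<epsilon>" "above_until b (1 - \<epsilon>)" "below_at c (1 - \<epsilon>)" "0 < b"
  shows "\<forall>\<^sub>F n in sequentially. time_ratio T (C n) \<epsilon> \<le> ereal (a / b)"
  using time_le[OF assms(1)] time_gt[OF assms(2,3)]
proof eventually_elim
  case (elim n)
  have b: "0 < b * \<tau> n" using assms(4) scale_pos by simp
  then have "real (T (C n) \<epsilon>) / real (T (C n) (1 - \<epsilon>)) \<le> (a * \<tau> n) / (b * \<tau> n)"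
    using elim by (intro frac_le) auto
  then show ?case
    using b elim scale_pos[of n] by (simp add: time_ratio_def)
qed

lemma ratio_ge:
  assumes "above_until a \<epsilon>" "below_at a' \<epsilon>" "below_at b (1 - \<epsilon>)" "above_until c (1 - \<epsilon>)"
    "0 < a" "0 < c"
  shows "\<forall>\<^sub>F n in sequentially. ereal (a / b) \<le> time_ratio T (C n) \<epsilon>"
  using time_gt[OF assms(1,2)] time_le[OF assms(3)] time_gt[OF assms(4,3)]
proof eventually_elim
  case (elim n)
  have c: "0 < c * \<tau> n" using assms(6) scale_pos by simp
  then have "(a * \<tau> n) / (b * \<tau> n) \<le> real (T (C n) \<epsilon>) / real (T (C n) (1 - \<epsilon>))"
    using elim assms(5) scale_pos[of n] by (intro frac_le) (auto simp: less_imp_le)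
  then show ?case
    using c elim scale_pos[of n] by (simp add: time_ratio_def)
qed

lemma below_atI:
  assumes "\<forall>\<^sub>F n in sequentially. \<exists>t. real t \<le> a * \<tau> n \<and> D (C n) t \<le> f n"
    and "f \<longlonglongrightarrow> l" "l < \<epsilon>"
  shows "below_at a \<epsilon>"
  unfolding below_at_def using assms(1) order_tendstoD(2)[OF assms(2,3)]
  by eventually_elim (meson less_imp_le order_trans)

lemma above_untilI:
  assumes "\<forall>\<^sub>F n in sequentially. \<forall>t. real t \<le> a * \<tau> n \<longrightarrow> f n \<le> D (C n) t"
    and "f \<longlonglongrightarrow> l" "\<epsilon> < l"
  shows "above_until a \<epsilon>"
  unfolding above_until_def using assms(1) order_tendstoD(1)[OF assms(2,3)]
  by eventually_elim (meson less_le_trans)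

text \<open>Eventually the ratio lies between \<open>(1 - \<delta>) / (1 + \<delta>)\<close> and
  \<open>(1 + \<delta>) / (1 - \<delta>)\<close>; both tend to 1 as \<open>\<delta>\<close> tends to
  0.\<close>

lemma cutoffI:
  assumes below: "\<And>\<delta> \<epsilon>. \<lbrakk>0 < \<delta>; \<delta> < 1; 0 < \<epsilon>\<rbrakk> \<Longrightarrow> below_at (1 + \<delta>) \<epsilon>"
    and above: "\<And>\<delta> \<epsilon>. \<lbrakk>0 < \<delta>; \<delta> < 1; 0 < \<epsilon>\<rbrakk> \<Longrightarrow> above_until (1 - \<delta>) (1 - \<epsilon>)"
  shows "cutoff T C"
  unfolding cutoff_def
proof
  fix \<epsilon> :: real assume \<epsilon>: "\<epsilon> \<in> {0<..1/2}"
  have *: "\<forall>\<^sub>F n in sequentially. time_ratio T (C n) \<epsilon> \<le> ereal ((1 + \<delta>) / (1 - \<delta>))"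
      "\<forall>\<^sub>F n in sequentially. ereal ((1 - \<delta>) / (1 + \<delta>)) \<le> time_ratio T (C n) \<epsilon>"
    if "0 < \<delta>" "\<delta> < 1" for \<delta>
    using ratio_le[of "1 + \<delta>" \<epsilon> "1 - \<delta>" "1 + \<delta>"]
      ratio_ge[of "1 - \<delta>" \<epsilon> "1 + \<delta>" "1 + \<delta>" "1 - \<delta>"]
      below[of \<delta> \<epsilon>] below[of \<delta> "1 - \<epsilon>"] above[of \<delta> \<epsilon>] above[of \<delta> "1 - \<epsilon>"] \<epsilon> that
    by auto
  have small: "\<forall>\<^sub>F \<delta> in at_right (0::real). 0 < \<delta> \<and> \<delta> < 1"
    by (auto simp: eventually_at_right_field intro!: exI[of _ 1])
  show "(\<lambda>n. time_ratio T (C n) \<epsilon>) \<longlonglongrightarrow> 1"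
  proof (rule order_tendstoI)
    fix a :: ereal assume a: "a < 1"
    have "((\<lambda>\<delta>::real. ereal ((1 - \<delta>) / (1 + \<delta>))) \<longlongrightarrow> ereal 1) (at_right 0)"
      by (intro tendsto_ereal) (auto intro!: tendsto_eq_intros)
    then have "\<forall>\<^sub>F \<delta> in at_right 0. a < ereal ((1 - \<delta>) / (1 + \<delta>))"
      using a by (intro order_tendstoD(1)) (auto simp: one_ereal_def)
    then obtain \<delta> where "0 < \<delta>" "\<delta> < 1" "a < ereal ((1 - \<delta>) / (1 + \<delta>))"
      using eventually_happens'[OF _ eventually_conj[OF small]] by force
    then show "\<forall>\<^sub>F n in sequentially. a < time_ratio T (C n) \<epsilon>"
      using *(2)[of \<delta>] by (auto elim!: eventually_mono)
  next
    fix a :: ereal assume a: "1 < a"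
    have "((\<lambda>\<delta>::real. ereal ((1 + \<delta>) / (1 - \<delta>))) \<longlongrightarrow> ereal 1) (at_right 0)"
      by (intro tendsto_ereal) (auto intro!: tendsto_eq_intros)
    then have "\<forall>\<^sub>F \<delta> in at_right 0. ereal ((1 + \<delta>) / (1 - \<delta>)) < a"
      using a by (intro order_tendstoD(2)) (auto simp: one_ereal_def)
    then obtain \<delta> where "0 < \<delta>" "\<delta> < 1" "ereal ((1 + \<delta>) / (1 - \<delta>)) < a"
      using eventually_happens'[OF _ eventually_conj[OF small]] by force
    then show "\<forall>\<^sub>F n in sequentially. time_ratio T (C n) \<epsilon> < a"
      using *(1)[of \<delta>] by (auto elim!: eventually_mono)
  qed
qed

text \<open>In units of \<open>\<tau>\<close> all times lie asymptotically between 1 and 2, so no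
  limiting ratio exceeds 2. Given \<open>\<delta>\<close>, a small enough \<open>\<epsilon>\<close>
  puts the time for \<open>1 - \<epsilon>\<close> before \<open>1 + \<delta>\<close> and the time
  for \<open>\<epsilon>\<close> after \<open>2 - \<delta>\<close>. How small depends on
  \<open>\<delta>\<close>, so 2 is obtained as a supremum over \<open>\<epsilon>\<close>.\<close>

lemma pre_cutoff_ratio_2:
  assumes below: "\<And>\<delta> \<epsilon>. \<lbrakk>0 < \<delta>; \<delta> < 1; 0 < \<epsilon>\<rbrakk> \<Longrightarrow> below_at (2 + \<delta>) \<epsilon>"
    and above: "\<And>\<delta> \<epsilon>. \<lbrakk>0 < \<delta>; \<delta> < 1; 0 < \<epsilon>\<rbrakk> \<Longrightarrow> above_until (1 - \<delta>) (1 - \<epsilon>)"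
    and early: "\<And>\<delta>. \<lbrakk>0 < \<delta>; \<delta> < 1\<rbrakk> \<Longrightarrow> \<exists>\<epsilon>>0. below_at (1 + \<delta>) (1 - \<epsilon>)"
    and late: "\<And>\<delta>. \<lbrakk>0 < \<delta>; \<delta> < 1\<rbrakk> \<Longrightarrow> above_until (2 - \<delta>) \<epsilon>\<^sub>1"
    and "0 < \<epsilon>\<^sub>1" "\<epsilon>\<^sub>1 < 1 / 2"
  shows "pre_cutoff_ratio T C = 2" "pre_cutoff T C" "\<not> cutoff T C"
proof -
  have small: "\<forall>\<^sub>F \<delta> in at_right (0::real). 0 < \<delta> \<and> \<delta> < 1"
    by (auto simp: eventually_at_right_field intro!: exI[of _ 1])
  have upper: "limsup (\<lambda>n. time_ratio T (C n) \<epsilon>) \<le> 2" if \<epsilon>: "\<epsilon> \<in> {0<..<1/2}" for \<epsilon>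
  proof -
    have lim: "((\<lambda>\<delta>::real. ereal ((2 + \<delta>) / (1 - \<delta>))) \<longlongrightarrow> ereal 2) (at_right 0)"
      by (intro tendsto_ereal) (auto intro!: tendsto_eq_intros)
    have "limsup (\<lambda>n. time_ratio T (C n) \<epsilon>) \<le> ereal ((2 + \<delta>) / (1 - \<delta>))"
      if "0 < \<delta>" "\<delta> < 1" for \<delta>
      using ratio_le[of "2 + \<delta>" \<epsilon> "1 - \<delta>" "2 + \<delta>"] below[of \<delta> \<epsilon>] below[of \<delta> "1 - \<epsilon>"]
        above[of \<delta> \<epsilon>] \<epsilon> that by (intro Limsup_bounded) auto
    then have "\<forall>\<^sub>F \<delta> in at_right 0. limsup (\<lambda>n. time_ratio T (C n) \<epsilon>) \<le> ereal ((2 + \<delta>) / (1 - \<delta>))"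
      using small by (auto elim!: eventually_mono)
    from tendsto_lowerbound[OF lim this] show ?thesis by simp
  qed
  have lower: "\<exists>\<epsilon>\<in>{0<..<1/2}. \<forall>\<^sub>F n in sequentially.
      ereal ((2 - \<delta>) / (1 + \<delta>)) \<le> time_ratio T (C n) \<epsilon>" if \<delta>: "0 < \<delta>" "\<delta> < 1" for \<delta>
  proof -
    from early[OF \<delta>] obtain \<epsilon>0 where \<epsilon>0: "0 < \<epsilon>0" "below_at (1 + \<delta>) (1 - \<epsilon>0)" by blast
    \<comment> \<open>Small enough both for the early drop to \<open>1 - \<epsilon>0\<close> and for
      the late lower bound \<open>\<epsilon>\<^sub>1\<close>.\<close>
    define \<epsilon> where "\<epsilon> = min \<epsilon>0 \<epsilon>\<^sub>1"
    have \<epsilon>: "\<epsilon> \<in> {0<..<1/2}" "\<epsilon> \<le> \<epsilon>\<^sub>1" "\<epsilon> \<le> \<epsilon>0"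
      using \<epsilon>0 assms(5,6) by (auto simp: \<epsilon>_def)
    have "\<forall>\<^sub>F n in sequentially. ereal ((2 - \<delta>) / (1 + \<delta>)) \<le> time_ratio T (C n) \<epsilon>"
      using \<delta> \<epsilon> by (intro ratio_ge[of _ _ "2 + \<delta>" _ "1 - \<delta>"] below above
          above_until_ge[OF late] below_at_le[OF \<epsilon>0(2)]) auto
    with \<epsilon>(1) show ?thesis by blast
  qed
  show eq: "pre_cutoff_ratio T C = 2"
  proof (rule antisym)
    show "pre_cutoff_ratio T C \<le> 2"
      unfolding pre_cutoff_ratio_def using upper by (intro SUP_least) auto
    have lim: "((\<lambda>\<delta>::real. ereal ((2 - \<delta>) / (1 + \<delta>))) \<longlongrightarrow> ereal 2) (at_right 0)"
      by (intro tendsto_ereal) (auto intro!: tendsto_eq_intros)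
    have "ereal ((2 - \<delta>) / (1 + \<delta>)) \<le> pre_cutoff_ratio T C" if \<delta>: "0 < \<delta>" "\<delta> < 1" for \<delta>
    proof -
      from lower[OF \<delta>] obtain \<epsilon> where \<epsilon>: "\<epsilon> \<in> {0<..<1/2}"
        "\<forall>\<^sub>F n in sequentially. ereal ((2 - \<delta>) / (1 + \<delta>)) \<le> time_ratio T (C n) \<epsilon>" by blast
      have "ereal ((2 - \<delta>) / (1 + \<delta>)) \<le> liminf (\<lambda>n. time_ratio T (C n) \<epsilon>)"
        using \<epsilon>(2) by (rule Liminf_bounded)
      also have "\<dots> \<le> limsup (\<lambda>n. time_ratio T (C n) \<epsilon>)"
        by (rule Liminf_le_Limsup) simp
      also have "\<dots> \<le> pre_cutoff_ratio T C"
        unfolding pre_cutoff_ratio_def using \<epsilon>(1) by (intro SUP_upper)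
      finally show ?thesis .
    qed
    then have "\<forall>\<^sub>F \<delta> in at_right 0. ereal ((2 - \<delta>) / (1 + \<delta>)) \<le> pre_cutoff_ratio T C"
      using small by (auto elim!: eventually_mono)
    from tendsto_upperbound[OF lim this] show "2 \<le> pre_cutoff_ratio T C" by simp
  qed
  then show "pre_cutoff T C" by (simp add: pre_cutoff_def)
  show "\<not> cutoff T C"
  proof
    assume "cutoff T C"
    \<comment> \<open>For \<open>\<delta> = 1/4\<close> the bound
      \<open>(2 - \<delta>) / (1 + \<delta>)\<close> is 7/5, which exceeds 1.\<close>
    from lower[of "1/4"] obtain \<epsilon> where \<epsilon>: "\<epsilon> \<in> {0<..<1/2}"
      "\<forall>\<^sub>F n in sequentially. ereal (7 / 5) \<le> time_ratio T (C n) \<epsilon>" by auto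
    from \<open>cutoff T C\<close> \<epsilon>(1) have "(\<lambda>n. time_ratio T (C n) \<epsilon>) \<longlonglongrightarrow> 1"
      by (auto simp: cutoff_def)
    from tendsto_lowerbound[OF this \<epsilon>(2)] show False by (simp add: one_ereal_def)
  qed
qed

end

section \<open>The chains\<close>

text \<open>A Chernoff bound with base \<open>a = 1 + \<delta>/2\<close>: for a walk that moves with
  probability 1/4 per step, the left side bounds the probability of fewer than \<open>R\<close>
  moves by time \<open>t\<close>. The typical time for \<open>R\<close> moves is
  \<open>4 * R\<close>.\<close>

lemma profile_decay_late:
  fixes \<delta> :: real and R t :: nat
  assumes "0 < \<delta>" "\<delta> < 1" "4 * (1 + \<delta>) * R \<le> t"
  shows "((3 + 1 / (1 + \<delta>/2)) / 4) ^ t * (1 + \<delta>/2) ^ R \<le> exp (- (\<delta>\<^sup>2 / 8) * R)"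
proof -
  define \<theta> where "\<theta> = \<delta> / 2"
  have \<theta>: "0 < \<theta>" "\<theta> < 1" "\<delta> = 2 * \<theta>" using assms by (auto simp: \<theta>_def)
  define c where "c = \<theta> / (4 * (1 + \<theta>))"
  have c: "0 \<le> c" using \<theta> by (simp add: c_def)
  have "(3 + 1 / (1 + \<theta>)) / 4 = 1 + - (\<theta> / (4 * (1 + \<theta>)))" using \<theta> by (simp add: field_simps)
  also have "\<dots> \<le> exp (- (\<theta> / (4 * (1 + \<theta>))))" by (rule exp_ge_add_one_self)
  finally have rate: "(3 + 1 / (1 + \<theta>)) / 4 \<le> exp (- c)" by (simp add: c_def)
  then have "((3 + 1 / (1 + \<theta>)) / 4) ^ t * (1 + \<theta>) ^ R
      \<le> exp (- c) ^ t * exp \<theta> ^ R"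
    using \<theta> by (intro mult_mono power_mono) auto
  also have "\<dots> = exp (\<theta> * R - t * c)"
    by (simp add: exp_of_nat_mult[symmetric] exp_add[symmetric] algebra_simps)
  also have "\<dots> \<le> exp (- (\<delta>\<^sup>2 / 8) * R)"
  proof -
    have "4 * (1 + \<delta>) * R * c \<le> t * c"
      using assms(3) c by (intro mult_right_mono) auto
    \<comment> \<open>The surplus \<open>\<theta>\<^sup>2 / 2 = \<delta>\<^sup>2 / 8\<close> is the
      decay rate left over once \<open>\<theta> * R\<close> is cancelled.\<close>
    moreover have "\<theta> + \<theta>\<^sup>2 / 2 \<le> 4 * (1 + \<delta>) * c"
    proof -
      have "(\<theta> + \<theta>\<^sup>2 / 2) * (1 + \<theta>) \<le> (1 + 2 * \<theta>) * \<theta>"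
        using mult_left_mono[of \<theta> 1 "\<theta>\<^sup>2"] \<theta> by (simp add: algebra_simps power2_eq_square)
      then show ?thesis using \<theta> by (simp add: c_def field_simps)
    qed
    then have "(\<theta> + \<theta>\<^sup>2 / 2) * R \<le> 4 * (1 + \<delta>) * c * R"
      by (rule mult_right_mono) simp
    ultimately show ?thesis using \<theta> by (simp add: algebra_simps power2_eq_square)
  qed
  finally show ?thesis by (simp add: \<theta>_def)
qed

text \<open>The opposite tail: with base \<open>1 - \<delta>/2 < 1\<close> the left side bounds the
  probability of at least \<open>R\<close> moves by time \<open>t\<close>.\<close>

lemma profile_decay_early:
  fixes \<delta> :: real and R t :: nat
  assumes "0 < \<delta>" "\<delta> < 1" "t \<le> 4 * (1 - \<delta>) * R"
  shows "((3 + 1 / (1 - \<delta>/2)) / 4) ^ t * (1 - \<delta>/2) ^ R \<le> exp (- (\<delta>\<^sup>2 / 8) * R)"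
proof -
  define \<theta> where "\<theta> = \<delta> / 2"
  have \<theta>: "0 < \<theta>" "\<theta> < 1/2" "\<delta> = 2 * \<theta>" using assms by (auto simp: \<theta>_def)
  define c where "c = \<theta> / (4 * (1 - \<theta>))"
  have c: "0 \<le> c" using \<theta> by (simp add: c_def)
  have "(3 + 1 / (1 - \<theta>)) / 4 = 1 + \<theta> / (4 * (1 - \<theta>))" using \<theta> by (simp add: field_simps)
  also have "\<dots> \<le> exp (\<theta> / (4 * (1 - \<theta>)))" by (rule exp_ge_add_one_self)
  finally have rate: "(3 + 1 / (1 - \<theta>)) / 4 \<le> exp c" by (simp add: c_def)
  then have "((3 + 1 / (1 - \<theta>)) / 4) ^ t * (1 - \<theta>) ^ R
      \<le> exp c ^ t * exp (- \<theta>) ^ R"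
    using \<theta> exp_ge_add_one_self[of "-\<theta>"] by (intro mult_mono power_mono) auto
  also have "\<dots> = exp (t * c - \<theta> * R)"
    by (simp add: exp_of_nat_mult[symmetric] exp_add[symmetric] algebra_simps)
  also have "\<dots> \<le> exp (- (\<delta>\<^sup>2 / 8) * R)"
  proof -
    have "t * c \<le> 4 * (1 - \<delta>) * R * c"
      using assms(3) c by (intro mult_right_mono) auto
    moreover have "4 * (1 - \<delta>) * c \<le> \<theta> - \<theta>\<^sup>2 / 2"
    proof -
      have "(1 - 2 * \<theta>) * \<theta> \<le> (\<theta> - \<theta>\<^sup>2 / 2) * (1 - \<theta>)"
      proof -
        have "0 \<le> \<theta>\<^sup>2 * (1 + \<theta>) / 2" using \<theta> by simp
        moreover have "(\<theta> - \<theta>\<^sup>2 / 2) * (1 - \<theta>) - (1 - 2 * \<theta>) * \<theta> = \<theta>\<^sup>2 * (1 + \<theta>) / 2"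
          by (simp add: field_simps power2_eq_square)
        ultimately show ?thesis by linarith
      qed
      then show ?thesis using \<theta> by (simp add: c_def field_simps)
    qed
    then have "4 * (1 - \<delta>) * c * R \<le> (\<theta> - \<theta>\<^sup>2 / 2) * R"
      by (rule mult_right_mono) simp
    ultimately show ?thesis using \<theta> by (simp add: algebra_simps power2_eq_square)
  qed
  finally show ?thesis by (simp add: \<theta>_def)
qed

text \<open>The common error term: the Chernoff tail, plus \<open>1 / L\<close> for all upward moves
  together (see \<open>error_le\<close>).\<close>

definition gap :: "nat \<Rightarrow> real \<Rightarrow> real" where
  "gap L \<delta> = exp (- (\<delta>\<^sup>2 / 8) * L) + 1 / L"

text \<open>The centre is \<open>0\<close>, the first leg is \<open>1, ..., L\<close>, and the second leg, with its extension if
  \<open>k = 2\<close>, is \<open>L + 1, ..., (k + 1) L\<close>; jumps occur above \<open>rim\<close>.  Downward moves have the prescribed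
  probabilities \<open>fwd\<close>, upward ones are dictated by reversibility with respect to \<open>wt\<close>.  The
  doubly exponential decay of \<open>wt\<close> makes \<open>wt z\<close> negligible against \<open>wt x * wt y\<close> for
  \<open>y < x < z\<close>.\<close>

locale leg_chain =
  fixes L k :: nat
  assumes L_ge_2: "2 \<le> L" and k_cases: "k = 1 \<or> k = 2"
begin

definition top_state :: nat where "top_state = (k + 1) * L"
definition rim :: nat where "rim = k * L"
text \<open>The centre for \<open>k = 1\<close>, and the leaf \<open>L\<close> of the first leg for
  \<open>k = 2\<close>.\<close>

definition target :: nat where "target = (k - 1) * L"
text \<open>The first state \<open>L + 1\<close> of the second leg is attached to the centre, not to
  \<open>L\<close>; truncated subtraction gives \<open>nxt 0 = 0\<close>.\<close>

definition nxt :: "nat \<Rightarrow> nat" where "nxt x = (if x = L + 1 then 0 else x - 1)"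
definition jump :: "nat \<Rightarrow> real" where "jump x = (if rim < x then 1 / L else 0)"
definition dist0 :: "nat \<Rightarrow> nat" where "dist0 x = (if x \<le> L then x else x - L)"
text \<open>The probability that none of the forward moves taking \<open>x\<close> down to the rim
  is a jump.\<close>

definition no_jump :: "nat \<Rightarrow> real" where "no_jump x = (1 - 1 / L) ^ (x - rim)"
text \<open>Pauses and forward moves have probability at least \<open>1 / (8 * real L)\<close>, and
  no time beyond \<open>40 * L\<close> is considered; so \<open>eta\<close> is at most the
  probability of any relevant path made of such steps.\<close>

definition eta :: real where "eta = (1 / (8 * real L)) ^ (40 * L)"
definition wt :: "nat \<Rightarrow> real" where "wt x = eta ^ (if x = 0 then 0 else 2 ^ x)"
text \<open>A sum of indicators, because \<open>nxt x\<close> and \<open>target\<close> coincide for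
  \<open>k = 1\<close> and \<open>x = L + 1\<close>.\<close>

definition fwd :: "nat \<Rightarrow> nat \<Rightarrow> real" where
  "fwd x y = ((1 - jump x) * of_bool (y = nxt x) + jump x * of_bool (y = target)) / 4"
definition off :: "nat \<Rightarrow> nat \<Rightarrow> real" where
  "off x y = (if y < x then fwd x y else wt y / wt x * fwd y x)"
definition tr :: "nat \<Rightarrow> nat \<Rightarrow> real" where
  "tr x y = (if x = y then 1 - (\<Sum>z\<in>{..top_state} - {x}. off x z) else off x y)"
definition legs :: "nat chain" where
  "legs = \<lparr>states = {..top_state}, prob = tr,
           stationary = (\<lambda>x. wt x / (\<Sum>z\<le>top_state. wt z))\<rparr>"

lemma legs_simps [simp]:
  "states legs = {..top_state}" "prob legs = tr"
  "stationary legs x = wt x / (\<Sum>z\<le>top_state. wt z)"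
  by (simp_all add: legs_def)

section \<open>Geometry of the legs and forward moves\<close>

lemma top_le: "top_state \<le> 3 * L" and rim_le: "rim \<le> 2 * L" "L \<le> rim" "rim < top_state"
  and top_rim: "top_state = rim + L" and top_ge: "2 * L \<le> top_state"
  using k_cases L_ge_2 by (auto simp: top_state_def rim_def)

lemma jump_nonneg: "0 \<le> jump x" and jump_le: "jump x \<le> 1 / 2"
  using L_ge_2 by (auto simp: jump_def field_simps)

lemma jump_below: "x \<le> rim \<Longrightarrow> jump x = 0"
  by (simp add: jump_def)

lemma nxt_less: "0 < x \<Longrightarrow> nxt x < x"
  by (simp add: nxt_def)

lemma nxt_0 [simp]: "nxt 0 = 0"
  by (simp add: nxt_def)

lemma jump_0 [simp]: "jump 0 = 0"
  by (simp add: jump_def)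

lemma dist0_0 [simp]: "dist0 0 = 0"
  by (simp add: dist0_def)

lemma dist0_pos: "0 < x \<Longrightarrow> 0 < dist0 x"
  by (auto simp: dist0_def)

lemma target_less: "rim < x \<Longrightarrow> target < x"
  using L_ge_2 k_cases by (auto simp: target_def rim_def)

lemma target_le_rim: "target \<le> rim"
  using L_ge_2 k_cases by (auto simp: target_def rim_def)

lemma dist0_nxt: "dist0 (nxt x) = dist0 x - 1"
  using L_ge_2 by (auto simp: dist0_def nxt_def)

lemma dist0_target: "rim < x \<Longrightarrow> dist0 target \<le> dist0 x - 1"
  using L_ge_2 k_cases by (auto simp: dist0_def target_def rim_def)

lemma no_jump_bounds: "0 \<le> no_jump x" "no_jump x \<le> 1"
  using L_ge_2 by (auto simp: no_jump_def power_le_one)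

lemma no_jump_below: "x \<le> rim \<Longrightarrow> no_jump x = 1"
  by (simp add: no_jump_def)

lemma no_jump_step: "(1 - jump x) * no_jump (nxt x) = no_jump x"
proof (cases "rim < x")
  case True
  \<comment> \<open>For \<open>k = 1\<close> and \<open>x = L + 1\<close>, \<open>nxt x = 0\<close>
    falls below \<open>rim\<close>, and truncated subtraction gives the desired 0.\<close>
  then have "x - rim = Suc (nxt x - rim)"
    using k_cases L_ge_2 by (auto simp: nxt_def rim_def)
  then show ?thesis using True by (simp add: no_jump_def jump_def)
next
  case False
  then have "nxt x \<le> rim" using nxt_less[of x] by (cases "x = 0") auto
  with False show ?thesis by (simp add: no_jump_below jump_below)
qed

lemma fwd_bounds: "0 \<le> fwd x y" "fwd x y \<le> 1 / 4"
  using jump_nonneg[of x] jump_le[of x] by (auto simp: fwd_def)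

lemma fwd_sum:
  assumes "0 < x"
  shows "(\<Sum>y<x. fwd x y * f y) = ((1 - jump x) * f (nxt x) + jump x * f target) / 4"
proof -
  have pick: "(\<Sum>y<x. of_bool (y = z) * f y) = f z" if "z < x" for z
    using that by (simp add: of_bool_def if_distrib[of "\<lambda>c. c * _"] cong: if_cong)
  have "(\<Sum>y<x. fwd x y * f y) = (1 - jump x) / 4 * (\<Sum>y<x. of_bool (y = nxt x) * f y)
      + jump x / 4 * (\<Sum>y<x. of_bool (y = target) * f y)"
    unfolding sum_distrib_left sum.distrib[symmetric]
    by (intro sum.cong) (auto simp: fwd_def field_simps)
  then show ?thesis
    using pick[OF nxt_less[OF assms]] pick[OF target_less[of x]]
    by (cases "rim < x") (auto simp: jump_below field_simps)
qed

section \<open>Smallness of the weights\<close>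

lemma eta_pos: "0 < eta"
  using L_ge_2 by (simp add: eta_def)

lemma eta_le_power:
  assumes "t \<le> 40 * L"
  shows "eta \<le> (1 / (8 * real L)) ^ t"
  unfolding eta_def using assms L_ge_2 by (intro power_decreasing) auto

text \<open>Upward moves cost at most \<open>top_state * eta\<close> per step; the total over
  \<open>40 * L\<close> steps stays below \<open>1 / L\<close> because \<open>eta\<close> is at most
  the third power of \<open>1 / (8 * real L)\<close>.\<close>

lemma error_le:
  assumes "t \<le> 40 * L"
  shows "real t * (top_state * eta) \<le> 1 / L"
proof -
  have "eta \<le> (1 / (8 * real L)) ^ 3" using L_ge_2 by (intro eta_le_power) simp
  then have "real t * (top_state * eta) \<le> real (40 * L) * (real (3 * L) * (1 / (8 * real L)) ^ 3)"
    using assms top_le eta_pos L_ge_2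
    by (intro mult_mono) (auto simp only: of_nat_le_iff of_nat_0_le_iff intro!: mult_nonneg_nonneg)
  also have "\<dots> \<le> 1 / L" using L_ge_2 by (simp add: field_simps power3_eq_cube)
  finally show ?thesis .
qed

lemma top_eta_le: "top_state * eta \<le> 1 / L" "top_state * eta \<le> 1 / 4"
proof -
  show "top_state * eta \<le> 1 / L" using error_le[of 1] L_ge_2 by simp
  have "real 4 * (top_state * eta) \<le> 1 / L" using L_ge_2 by (intro error_le) simp
  also have "\<dots> \<le> 1" using L_ge_2 by simp
  finally show "top_state * eta \<le> 1 / 4" by simp
qed

lemma eta_le_1: "eta \<le> 1"
  using eta_le_power[of 0] by simp

lemma wt_pos: "0 < wt x"
  using eta_pos by (simp add: wt_def)

lemma wt_0 [simp]: "wt 0 = 1"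
  by (simp add: wt_def)

lemma wt_le_eta: "0 < x \<Longrightarrow> wt x \<le> eta"
  using power_decreasing[of 1 "2^x" eta] eta_pos eta_le_1 by (simp add: wt_def)

lemma wt_prod_le:
  assumes "y < x" "x < z"
  shows "wt z \<le> eta * (wt x * wt y)"
proof -
  let ?e = "\<lambda>x::nat. if x = 0 then 0 else 2 ^ x :: nat"
  have "2 * 2 ^ y \<le> (2::nat) ^ x" "2 * 2 ^ x \<le> (2::nat) ^ z"
    using assms power_increasing[of "Suc y" x "2::nat"] power_increasing[of "Suc x" z "2::nat"]
    by auto
  moreover have "1 \<le> (2::nat) ^ y" by simp
  ultimately have "Suc (2 ^ x + 2 ^ y) \<le> (2::nat) ^ z" by linarith
  then have "Suc (?e x + ?e y) \<le> ?e z" using assms by auto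
  then have "eta ^ ?e z \<le> eta ^ Suc (?e x + ?e y)"
    using eta_pos eta_le_1 by (intro power_decreasing) auto
  then show ?thesis by (simp add: wt_def power_add)
qed

lemma wt_mono_eta: "x < z \<Longrightarrow> wt z \<le> eta * wt x"
  using wt_prod_le[of 0 x z] wt_le_eta[of z] by (cases "x = 0") auto

section \<open>The transition matrix: laziness, reversibility and mass of the centre\<close>

lemma off_nonneg: "0 \<le> off x y"
  using wt_pos[of x] wt_pos[of y] fwd_bounds by (auto simp: off_def)

lemma off_up_le:
  assumes "x < y" shows "off x y \<le> wt y / wt x"
  using assms wt_pos[of x] wt_pos[of y] fwd_bounds(2)[of y x]
    mult_left_mono[of "fwd y x" 1 "wt y / wt x"] by (auto simp: off_def)

lemma off_up_le_eta:
  assumes "x < y" shows "off x y \<le> eta"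
proof -
  have "wt y / wt x \<le> eta"
    using wt_mono_eta[OF assms] wt_pos[of x] by (simp add: pos_divide_le_eq)
  with off_up_le[OF assms] show ?thesis by linarith
qed

lemma sum_up_le:
  assumes "\<And>z. \<lbrakk>x < z; z \<le> top_state\<rbrakk> \<Longrightarrow> f z \<le> eta"
  shows "(\<Sum>z\<in>{x<..top_state}. f z) \<le> top_state * eta"
proof -
  have "(\<Sum>z\<in>{x<..top_state}. f z) \<le> card {x<..top_state} * eta"
    using assms by (intro sum_bounded_above) auto
  also have "\<dots> \<le> top_state * eta"
    using eta_pos by (intro mult_right_mono) auto
  finally show ?thesis .
qed

lemma split_states:
  assumes "x \<le> top_state"
  shows "(\<Sum>z\<in>{..top_state} - {x}. g z) = (\<Sum>z<x. g z) + (\<Sum>z\<in>{x<..top_state}. g z)"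
proof -
  have "{..top_state} - {x} = {..<x} \<union> {x<..top_state}" using assms by auto
  moreover have "(\<Sum>z\<in>{..<x} \<union> {x<..top_state}. g z)
      = (\<Sum>z<x. g z) + (\<Sum>z\<in>{x<..top_state}. g z)"
    by (intro sum.union_disjoint) auto
  ultimately show ?thesis by simp
qed

text \<open>Away from the centre forward moves take exactly 1/4, and upward moves at most another
  1/4, which leaves at least 1/2 for resting.\<close>

lemma tr_diag:
  assumes "x \<le> top_state"
  shows "1 / 2 \<le> tr x x" and "tr x x \<le> 1" and "0 < x \<Longrightarrow> tr x x \<le> 3 / 4"
proof -
  have up: "(\<Sum>z\<in>{x<..top_state}. off x z) \<le> 1 / 4" "0 \<le> (\<Sum>z\<in>{x<..top_state}. off x z)"
    using sum_up_le[of x "off x"] off_up_le_eta top_eta_le(2)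
    by (auto intro!: sum_nonneg off_nonneg intro: order_trans)
  have down: "x \<noteq> 0 \<Longrightarrow> (\<Sum>z<x. off x z) = 1 / 4" "x = 0 \<Longrightarrow> (\<Sum>z<x. off x z) = 0"
    using fwd_sum[of x "\<lambda>_. 1"] by (simp_all add: off_def)
  from up obtain c where c: "0 \<le> c" "c \<le> 1 / 4" "(\<Sum>z\<in>{x<..top_state}. off x z) = c" by blast
  have eq: "x \<noteq> 0 \<Longrightarrow> tr x x = 3 / 4 - c" "x = 0 \<Longrightarrow> tr x x = 1 - c"
    using split_states[OF assms, of "off x"] down c(3) by (simp_all add: tr_def)
  show "1 / 2 \<le> tr x x" using c(1,2) eq by (cases "x = 0") simp_all
  show "tr x x \<le> 1" using c(1,2) eq by (cases "x = 0") simp_all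
  show "tr x x \<le> 3 / 4" if "0 < x" using that c(1,2) eq by simp
qed

lemma tr_nonneg: "x \<le> top_state \<Longrightarrow> 0 \<le> tr x y"
  using tr_diag(1)[of x] off_nonneg[of x y] by (cases "x = y") (auto simp: tr_def)

lemma tr_sum: "x \<le> top_state \<Longrightarrow> (\<Sum>y\<le>top_state. tr x y) = 1"
  by (subst sum.remove[of _ x]) (auto simp: tr_def intro!: sum.cong)

lemma wt_tr: "wt x * tr x y = wt y * tr y x"
  using wt_pos[of x] wt_pos[of y] by (cases x y rule: linorder_cases) (auto simp: tr_def off_def)

lemma wt_total_ge: "1 \<le> (\<Sum>z\<le>top_state. wt z)"
  using member_le_sum[of 0 "{..top_state}" wt] wt_pos by (auto simp: less_imp_le)

lemma wt_total_le: "(\<Sum>z\<le>top_state. wt z) \<le> 1 + 1 / L"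
proof -
  have "(\<Sum>z\<in>{0<..top_state}. wt z) \<le> top_state * eta"
    by (intro sum_up_le wt_le_eta)
  moreover have "(\<Sum>z\<le>top_state. wt z) = wt 0 + (\<Sum>z\<in>{0<..top_state}. wt z)"
    using split_states[of 0 wt] by (simp add: sum.remove[of _ 0])
  ultimately show ?thesis using top_eta_le by simp
qed

lemma stationary_0_ge: "1 - 1 / L \<le> stationary legs 0"
proof -
  have "(1 - 1 / L) * (\<Sum>z\<le>top_state. wt z) \<le> (1 - 1 / L) * (1 + 1 / real L)"
    using L_ge_2 wt_total_le by (intro mult_left_mono) auto
  also have "\<dots> \<le> 1" by (simp add: algebra_simps)
  finally show ?thesis using wt_total_ge by (simp add: pos_le_divide_eq)
qed

sublocale reversible_markov legs
proof
  let ?Z = "\<Sum>z\<le>top_state. wt z"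
  have Z: "0 < ?Z" using wt_total_ge by linarith
  have rev: "stationary legs x * tr x y = stationary legs y * tr y x" for x y
    using wt_tr[of x y] by simp
  have "(\<Sum>x\<le>top_state. stationary legs x * tr x y) = stationary legs y" if "y \<le> top_state" for y
  proof -
    have "(\<Sum>x\<le>top_state. stationary legs x * tr x y)
        = stationary legs y * (\<Sum>x\<le>top_state. tr y x)"
      unfolding sum_distrib_left by (intro sum.cong refl rev)
    with tr_sum[OF that] show ?thesis by simp
  qed
  then show "finite_markov_chain legs"
    using tr_nonneg tr_sum Z wt_pos
    by (auto simp: finite_markov_chain_def stochastic_matrix_def stationary_distribution_def
        sum_divide_distrib[symmetric] less_imp_le)
  show "reversible_chain legs" using rev by (simp add: reversible_chain_def)
  show "0 < stationary legs x" for x using Z wt_pos by simp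
qed

lemma lazy: "lazy_chain legs"
  using tr_diag(1) by (simp add: lazy_chain_def)

text \<open>Reduces one-step estimates to forward moves plus an upward remainder. At the centre
  \<open>nxt 0 = 0\<close> and \<open>jump 0 = 0\<close>, so the first two terms add up to
  \<open>f 0\<close>.\<close>

lemma one_step:
  assumes "x \<le> top_state" "\<And>z. z \<le> top_state \<Longrightarrow> 0 \<le> f z"
  shows "(\<Sum>z\<le>top_state. tr x z * f z)
    \<le> 3 / 4 * f x + ((1 - jump x) * f (nxt x) + jump x * f target) / 4
      + (\<Sum>z\<in>{x<..top_state}. tr x z * f z)"
proof -
  have "(\<Sum>z\<le>top_state. tr x z * f z) = tr x x * f x + (\<Sum>z<x. tr x z * f z)
      + (\<Sum>z\<in>{x<..top_state}. tr x z * f z)"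
    using assms(1) split_states[OF assms(1), of "\<lambda>z. tr x z * f z"]
    by (simp add: sum.remove[of _ x])
  moreover have "(\<Sum>z<x. tr x z * f z) = (\<Sum>z<x. fwd x z * f z)"
    by (intro sum.cong) (auto simp: tr_def off_def)
  moreover have "tr x x * f x + (\<Sum>z<x. fwd x z * f z)
      \<le> 3 / 4 * f x + ((1 - jump x) * f (nxt x) + jump x * f target) / 4"
  proof (cases "x = 0")
    case True
    then show ?thesis
      using mult_right_mono[OF tr_diag(2)[OF assms(1)] assms(2)[OF assms(1)]] by simp
  next
    case False
    then show ?thesis
      using mult_right_mono[OF tr_diag(3)[OF assms(1)] assms(2)[OF assms(1)]] fwd_sum[of x f]
      by linarith
  qed
  ultimately show ?thesis by linarith
qed

section \<open>Inductive bounds for travel times, jumps and densities\<close>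

definition profile :: "real \<Rightarrow> nat \<Rightarrow> nat \<Rightarrow> real" where
  "profile a t r = ((3 + 1 / a) / 4) ^ t * a ^ r"

lemma profile_nonneg: "0 < a \<Longrightarrow> 0 \<le> profile a t r"
  by (simp add: profile_def)

text \<open>The Chernoff bound for \<open>r\<close> remaining moves obeys the recursion of a walk
  that rests with probability 3/4 and otherwise moves one closer.\<close>

lemma profile_step:
  assumes "0 < a" "0 < r"
  shows "3 / 4 * profile a t r + profile a t (r - 1) / 4 = profile a (Suc t) r"
proof -
  obtain q where "r = Suc q" using assms(2) by (cases r) auto
  then show ?thesis using assms(1) by (simp add: profile_def field_simps)
qed

lemma profile_mono: "1 \<le> a \<Longrightarrow> r \<le> r' \<Longrightarrow> profile a t r \<le> profile a t r'"
  unfolding profile_def by (intro mult_left_mono power_increasing) auto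

lemma step_0_nonneg: "z \<le> top_state \<Longrightarrow> y \<le> top_state \<Longrightarrow> 0 \<le> step_prob legs t z y"
  using step_nonneg[of z y] by simp

lemma step_0_le_1: "z \<le> top_state \<Longrightarrow> y \<le> top_state \<Longrightarrow> step_prob legs t z y \<le> 1"
  using step_le_1[of z y] by simp

lemma one_step_le:
  assumes "x \<le> top_state" "\<And>z. z \<le> top_state \<Longrightarrow> 0 \<le> f z"
    and "f x \<le> u" "(1 - jump x) * f (nxt x) + jump x * f target \<le> v"
    and "\<And>z. \<lbrakk>x < z; z \<le> top_state\<rbrakk> \<Longrightarrow> tr x z * f z \<le> eta"
  shows "(\<Sum>z\<le>top_state. tr x z * f z) \<le> 3 / 4 * u + v / 4 + top_state * eta"
proof -
  have "s \<le> 3 / 4 * u + v / 4 + c" if "s \<le> 3 / 4 * a + b / 4 + d" "a \<le> u" "b \<le> v" "d \<le> c"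
    for s a b c d :: real using that by linarith
  from this[OF one_step[OF assms(1,2)] assms(3,4) sum_up_le[OF assms(5)]] show ?thesis .
qed

lemma up_move_le:
  assumes "x < z" "0 \<le> c" "c \<le> 1"
  shows "tr x z * c \<le> eta"
proof -
  have "tr x z * c \<le> off x z"
    using assms off_nonneg[of x z] by (auto simp: tr_def intro!: mult_left_le)
  with off_up_le_eta[OF assms(1)] show ?thesis by linarith
qed

lemma step_from_centre:
  assumes "x \<le> top_state"
  shows "step_prob legs t 0 x / wt x = step_prob legs t x 0"
proof -
  have "(\<Sum>z\<le>top_state. wt z) \<noteq> 0" using wt_total_ge by linarith
  with step_reversible[of 0 x t] assms wt_pos[of x] show ?thesis by (simp add: field_simps)
qed

text \<open>\<open>profile_step\<close> needs a positive distance, so the centre gets a bound of its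
  own and both run through one induction. A jump shortens the way by at least one, which is harmless
  since the profile increases with the distance for \<open>a \<ge> 1\<close>.\<close>

lemma not_at_centre_le:
  assumes "1 \<le> a"
  shows "1 - step_prob legs t 0 0 \<le> t * (top_state * eta)"
    and "x \<le> top_state \<Longrightarrow>
      1 - step_prob legs t x 0 \<le> profile a t (dist0 x) + t * (top_state * eta)"
proof (induction t arbitrary: x)
  case 0
  { case 1 then show ?case by simp
  next
    case 2
    have "1 \<le> a ^ dist0 x" using assms by simp
    then show ?case by (simp add: profile_def)
  }
next
  case (Suc t)
  let ?u = "\<lambda>x. 1 - step_prob legs t x 0" and ?e = "top_state * eta"
  have bounds: "0 \<le> ?u z" "?u z \<le> 1" if "z \<le> top_state" for z
    using that step_0_nonneg[of z 0 t] step_0_le_1[of z 0 t] by auto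
  have rec: "1 - step_prob legs (Suc t) x 0 \<le> 3 / 4 * u + v / 4 + ?e"
    if x: "x \<le> top_state" and "?u x \<le> u" "(1 - jump x) * ?u (nxt x) + jump x * ?u target \<le> v"
    for x u v
  proof -
    have "1 - step_prob legs (Suc t) x 0 = (\<Sum>z\<le>top_state. tr x z * ?u z)"
      using tr_sum[OF x] by (simp add: right_diff_distrib sum_subtractf)
    also have "\<dots> \<le> 3 / 4 * u + v / 4 + ?e"
      using that bounds by (intro one_step_le up_move_le)
    finally show ?thesis .
  qed
  have centre: "1 - step_prob legs (Suc t) 0 0 \<le> Suc t * ?e"
  proof -
    have "1 - step_prob legs (Suc t) 0 0 \<le> 3 / 4 * (t * ?e) + (t * ?e) / 4 + ?e"
      using Suc.IH(1) by (intro rec) auto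
    then show ?thesis by (simp add: algebra_simps del: step_prob.simps)
  qed
  { case 1
    show ?case by (rule centre)
  next
    case 2
    show ?case
    proof (cases "x = 0")
      case True
      then show ?thesis
        using centre profile_nonneg[of a "Suc t" 0] assms by (simp del: step_prob.simps)
    next
      case False
      let ?p = "profile a t (dist0 x - 1) + t * ?e"
      have n: "?u (nxt x) \<le> ?p"
        using Suc.IH(2)[of "nxt x"] nxt_less[of x] False 2 by (simp add: dist0_nxt)
      have j: "jump x * ?u target \<le> jump x * ?p"
      proof (cases "rim < x")
        case True
        have "?u target \<le> profile a t (dist0 target) + t * ?e"
          using Suc.IH(2)[of target] target_less[OF True] 2 by simp
        also have "\<dots> \<le> ?p" using profile_mono[OF assms dist0_target[OF True]] by simp
        finally show ?thesis using jump_nonneg by (intro mult_left_mono)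
      qed (simp add: jump_below)
      have "(1 - jump x) * ?u (nxt x) + jump x * ?u target \<le> (1 - jump x) * ?p + jump x * ?p"
        using n jump_le[of x] by (intro add_mono[OF _ j] mult_left_mono) auto
      also have "\<dots> = ?p" by (simp add: algebra_simps)
      finally have "1 - step_prob legs (Suc t) x 0
          \<le> 3 / 4 * (profile a t (dist0 x) + t * ?e) + ?p / 4 + ?e"
        using Suc.IH(2) 2 by (intro rec) auto
      also have "\<dots> = profile a (Suc t) (dist0 x) + Suc t * ?e"
        using profile_step[of a "dist0 x" t, symmetric] assms dist0_pos[of x] False
        by (simp add: field_simps)
      finally show ?thesis .
    qed }
qed

text \<open>From beyond the rim each step jumps with probability \<open>1 / (4 * L)\<close> and
  lands within the rim; returning takes an upward move, charged \<open>top_state * eta\<close> per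
  step.\<close>

lemma beyond_rim_le:
  assumes "x \<le> top_state"
  shows "(\<Sum>y\<in>{rim<..top_state}. step_prob legs t x y)
    \<le> of_bool (rim < x) * (1 - 1 / (4 * L)) ^ t + t * (top_state * eta)"
  using assms
proof (induction t arbitrary: x)
  case 0
  then show ?case by (auto simp: sum.delta)
next
  case (Suc t)
  let ?u = "\<lambda>x. \<Sum>y\<in>{rim<..top_state}. step_prob legs t x y" and ?e = "top_state * eta"
    and ?b = "(1 - 1 / (4 * real L))"
  have "{rim<..top_state} \<subseteq> {..top_state}" by auto
  then have bounds: "0 \<le> ?u z" "?u z \<le> 1" if "z \<le> top_state" for z
    using that step_sum_le_1[of z "{rim<..top_state}" t]
    by (auto intro!: sum_nonneg step_0_nonneg)
  have "(\<Sum>y\<in>{rim<..top_state}. step_prob legs (Suc t) x y) = (\<Sum>z\<le>top_state. tr x z * ?u z)"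
    by (simp add: sum_distrib_left) (rule sum.swap)
  also have "\<dots> \<le> 3 / 4 * u + v / 4 + ?e"
    if "?u x \<le> u" "(1 - jump x) * ?u (nxt x) + jump x * ?u target \<le> v" for u v
    using Suc.prems that bounds by (intro one_step_le up_move_le)
  finally have rec: "(\<Sum>y\<in>{rim<..top_state}. step_prob legs (Suc t) x y) \<le> 3 / 4 * u + v / 4 + ?e"
    if "?u x \<le> u" "(1 - jump x) * ?u (nxt x) + jump x * ?u target \<le> v" for u v
    using that .
  have b: "0 \<le> ?b" using L_ge_2 by (simp add: field_simps)
  have n_le: "nxt x \<le> top_state" using Suc.prems by (auto simp: nxt_def)
  show ?case
  proof (cases "rim < x")
    case True
    have "?u (nxt x) \<le> ?b ^ t + t * ?e"
      using Suc.IH[OF n_le] zero_le_power[OF b, of t]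
      by (cases "rim < nxt x") (simp_all del: zero_le_power)
    then have "(1 - jump x) * ?u (nxt x) \<le> (1 - jump x) * (?b ^ t + t * ?e)"
      using jump_le[of x] by (intro mult_left_mono) auto
    moreover have "?u target \<le> t * ?e"
      using Suc.IH[of target] target_le_rim rim_le by simp
    then have "jump x * ?u target \<le> jump x * (t * ?e)"
      using jump_nonneg by (intro mult_left_mono)
    ultimately have "(\<Sum>y\<in>{rim<..top_state}. step_prob legs (Suc t) x y)
        \<le> 3 / 4 * (?b ^ t + t * ?e) + ((1 - jump x) * (?b ^ t + t * ?e) + jump x * (t * ?e)) / 4 + ?e"
      using Suc.IH[OF Suc.prems] True by (intro rec add_mono) auto
    also have "\<dots> = ?b ^ t * (1 - jump x / 4) + Suc t * ?e" by (simp add: field_simps)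
    also have "\<dots> = ?b ^ Suc t + Suc t * ?e" using True by (simp add: jump_def)
    finally show ?thesis using True by simp
  next
    case False
    then have "?u (nxt x) \<le> t * ?e"
      using Suc.IH[OF n_le] nxt_less[of x] by (cases "x = 0") auto
    then have "(\<Sum>y\<in>{rim<..top_state}. step_prob legs (Suc t) x y)
        \<le> 3 / 4 * (t * ?e) + (t * ?e) / 4 + ?e"
      using Suc.IH[OF Suc.prems] False by (intro rec) (auto simp: jump_below)
    also have "\<dots> = Suc t * ?e" by (simp add: algebra_simps)
    finally show ?thesis using False by simp
  qed
qed

text \<open>A jump is conceded as a success, and \<open>no_jump_step\<close> adds these up to
  \<open>1 - no_jump x\<close>. Otherwise the profile recursion applies with \<open>r\<close>
  further moves beyond the centre: none in \<open>at_centre_le\<close>, \<open>L\<close> in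
  \<open>leaf_density_le\<close>.\<close>

lemma arrival_step:
  assumes x: "0 < x" "x \<le> top_state" and "0 < a" "0 \<le> c"
    and f: "\<And>z. z \<le> top_state \<Longrightarrow> 0 \<le> f z"
    and fx: "f x \<le> 1 - no_jump x + profile a t (dist0 x + r) + c"
    and fn: "f (nxt x) \<le> 1 - no_jump (nxt x) + profile a t (dist0 x - 1 + r) + c"
    and ft: "jump x * f target \<le> jump x"
    and up: "\<And>z. \<lbrakk>x < z; z \<le> top_state\<rbrakk> \<Longrightarrow> tr x z * f z \<le> eta"
  shows "(\<Sum>z\<le>top_state. tr x z * f z)
    \<le> 1 - no_jump x + profile a (Suc t) (dist0 x + r) + (c + top_state * eta)"
proof -
  let ?p = "profile a t (dist0 x - 1 + r)"
  have p: "0 \<le> ?p" using \<open>0 < a\<close> by (rule profile_nonneg)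
  have "(1 - jump x) * f (nxt x) \<le> (1 - jump x) * (1 - no_jump (nxt x) + ?p + c)"
    using fn jump_le[of x] by (intro mult_left_mono) auto
  also have "\<dots> = (1 - jump x) - no_jump x + (1 - jump x) * (?p + c)"
    using no_jump_step[of x] by (simp add: algebra_simps)
  also have "(1 - jump x) * (?p + c) \<le> ?p + c"
    using p \<open>0 \<le> c\<close> jump_nonneg[of x] jump_le[of x] by (intro mult_left_le_one_le) auto
  finally have "(1 - jump x) * f (nxt x) + jump x * f target \<le> 1 - no_jump x + (?p + c)"
    using ft by linarith
  then have "(\<Sum>z\<le>top_state. tr x z * f z)
      \<le> 3 / 4 * (1 - no_jump x + profile a t (dist0 x + r) + c) + (1 - no_jump x + (?p + c)) / 4
        + top_state * eta"
    using x(2) f fx up by (intro one_step_le)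
  also have "\<dots> = 1 - no_jump x + profile a (Suc t) (dist0 x + r) + (c + top_state * eta)"
    using profile_step[of a "dist0 x + r" t, symmetric] \<open>0 < a\<close> dist0_pos[OF x(1)]
    by (simp add: field_simps)
  finally show ?thesis .
qed

text \<open>Up to upward moves, arrival takes either a jump or \<open>dist0 x\<close> ordinary
  moves; the profile with \<open>a \<le> 1\<close> bounds the probability that the latter fit into
  \<open>t\<close> steps.\<close>

lemma at_centre_le:
  assumes "0 < a" "a \<le> 1" "x \<le> top_state"
  shows "step_prob legs t x 0 \<le> 1 - no_jump x + profile a t (dist0 x) + t * (top_state * eta)"
  using assms(3)
proof (induction t arbitrary: x)
  case 0
  have "0 \<le> profile a 0 (dist0 x)" using assms by (intro profile_nonneg)
  then show ?case using no_jump_bounds[of x] by (cases "x = 0") (auto simp: profile_def)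
next
  case (Suc t)
  let ?e = "top_state * eta"
  show ?case
  proof (cases "x = 0")
    case True
    \<comment> \<open>At distance 0 the profile is at least 1, so the claim is trivial.\<close>
    have "1 \<le> ((3 + 1 / a) / 4) ^ Suc t" using assms by (intro one_le_power) simp
    moreover have "step_prob legs (Suc t) 0 0 \<le> 1" by (rule step_0_le_1) auto
    moreover have "0 \<le> Suc t * ?e" using eta_pos by simp
    ultimately show ?thesis
      unfolding True using no_jump_bounds[of 0] by (simp add: profile_def del: step_prob.simps power_Suc of_nat_Suc)
  next
    case False
    have "(\<Sum>z\<le>top_state. tr x z * step_prob legs t z 0)
        \<le> 1 - no_jump x + profile a (Suc t) (dist0 x + 0) + (t * ?e + ?e)"
    proof (rule arrival_step)
      show "step_prob legs t (nxt x) 0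
          \<le> 1 - no_jump (nxt x) + profile a t (dist0 x - 1 + 0) + t * ?e"
        using Suc.IH[of "nxt x"] nxt_less[of x] False Suc.prems by (simp add: dist0_nxt)
      show "jump x * step_prob legs t target 0 \<le> jump x"
        using jump_nonneg target_le_rim rim_le by (intro mult_left_le step_0_le_1) auto
      show "tr x z * step_prob legs t z 0 \<le> eta" if "x < z" "z \<le> top_state" for z
        using that by (intro up_move_le step_0_nonneg step_0_le_1) auto
    qed (use False Suc assms eta_pos step_0_nonneg in auto)
    then show ?thesis by (simp add: algebra_simps)
  qed
qed

text \<open>For the leaf \<open>L\<close> of the first leg and a state \<open>x\<close> of the second one, every path between
  them that avoids the centre climbs to a state \<open>z > x\<close>.  Since \<open>wt z\<close> is negligible even
  against the product \<open>wt x * wt L\<close>, such paths do not contribute to the density.\<close>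

lemma leaf_density_le:
  assumes "0 < a" "a \<le> 1" "x = 0 \<or> L < x \<and> x \<le> 2 * L"
  shows "step_prob legs t x L / wt L
    \<le> 1 - no_jump x + profile a t (dist0 x + L) + t * (top_state * eta)"
  using assms(3)
proof (induction t arbitrary: x)
  case 0
  have "0 \<le> profile a 0 (dist0 x + L)" using assms by (intro profile_nonneg)
  then show ?case using no_jump_bounds[of x] 0 L_ge_2 by auto
next
  case (Suc t)
  let ?e = "top_state * eta"
  have L_le: "L \<le> top_state" using top_ge by simp
  show ?case
  proof (cases "x = 0")
    case True
    \<comment> \<open>Reversibility turns this density into the probability of arriving at the
      centre from the leaf \<open>L\<close>, whose way has no jumps.\<close>
    have "step_prob legs (Suc t) 0 L / wt L = step_prob legs (Suc t) L 0"
      using L_le by (rule step_from_centre)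
    also have "\<dots> \<le> 1 - no_jump L + profile a (Suc t) (dist0 L) + Suc t * ?e"
      using assms L_le by (intro at_centre_le)
    finally show ?thesis
      unfolding True using rim_le by (simp add: no_jump_below dist0_def del: step_prob.simps)
  next
    case False
    with Suc.prems have x: "L < x" "x \<le> 2 * L" by auto
    have nonneg: "0 \<le> step_prob legs t z L / wt L" if "z \<le> top_state" for z
      using that step_0_nonneg[OF that L_le] wt_pos[of L] by simp
    have nxt_cases: "nxt x = 0 \<or> L < nxt x \<and> nxt x \<le> 2 * L"
      using x by (auto simp: nxt_def)
    have "(\<Sum>z\<le>top_state. tr x z * (step_prob legs t z L / wt L))
        \<le> 1 - no_jump x + profile a (Suc t) (dist0 x + L) + (t * ?e + ?e)"
    proof (rule arrival_step)
      show "step_prob legs t (nxt x) L / wt L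
          \<le> 1 - no_jump (nxt x) + profile a t (dist0 x - 1 + L) + t * ?e"
        using Suc.IH[OF nxt_cases] by (simp add: dist0_nxt)
      show "jump x * (step_prob legs t target L / wt L) \<le> jump x"
      proof (cases "rim < x")
        case True
        \<comment> \<open>For \<open>k = 2\<close> no state up to \<open>2 * L\<close> lies beyond
          the rim; hence \<open>k = 1\<close>, and the jump goes to the centre.\<close>
        then have "target = 0" using k_cases x by (auto simp: rim_def target_def)
        moreover have "step_prob legs t 0 L / wt L \<le> 1"
          using step_0_le_1[OF L_le, of 0 t] step_from_centre[OF L_le] by simp
        ultimately show ?thesis using jump_nonneg by (intro mult_left_le) auto
      qed (simp add: jump_below)
      fix z assume z: "x < z" "z \<le> top_state"
      have "tr x z * (step_prob legs t z L / wt L) \<le> (wt z / wt x) * (1 / wt L)"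
        using z off_up_le[OF z(1)] off_nonneg[of x z] step_0_le_1[OF z(2) L_le, of t] nonneg[OF z(2)]
          wt_pos[of L] wt_pos[of x] wt_pos[of z]
        by (intro mult_mono) (auto simp: tr_def divide_right_mono)
      also have "\<dots> \<le> eta"
        using wt_prod_le[OF x(1) z(1)] wt_pos[of x] wt_pos[of L] by (simp add: field_simps)
      finally show "tr x z * (step_prob legs t z L / wt L) \<le> eta" .
    next
      show "step_prob legs t x L / wt L \<le> 1 - no_jump x + profile a t (dist0 x + L) + t * ?e"
        using Suc.IH[of x] x by simp
    qed (use x assms eta_pos nonneg top_ge in auto)
    then show ?thesis by (simp add: sum_divide_distrib algebra_simps)
  qed
qed

section \<open>Lower bounds along forward paths, and irreducibility\<close>

lemma tr_self_ge: "x \<le> top_state \<Longrightarrow> 1 / (8 * real L) \<le> tr x x"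
  using tr_diag(1)[of x] L_ge_2 frac_le[of 1 1 2 "8 * real L"] by linarith

lemma tr_nxt_ge:
  assumes "0 < x"
  shows "1 / (8 * real L) \<le> tr x (nxt x)"
proof -
  have "1 / (8 * real L) \<le> 1 / 8" using L_ge_2 by (simp add: field_simps)
  also have "1 / 8 \<le> (1 - jump x) / 4" using jump_le[of x] by simp
  also have "\<dots> \<le> tr x (nxt x)"
    using nxt_less[OF assms] jump_nonneg[of x] by (simp add: tr_def off_def fwd_def)
  finally show ?thesis .
qed

lemma tr_target_ge:
  assumes "rim < x"
  shows "1 / (8 * real L) \<le> tr x target"
proof -
  have "1 / (8 * real L) \<le> jump x / 4" using assms L_ge_2 by (simp add: jump_def field_simps)
  also have "\<dots> \<le> tr x target"
    using target_less[OF assms] jump_le[of x] by (simp add: tr_def off_def fwd_def)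
  finally show ?thesis .
qed

text \<open>Descend to \<open>y\<close> one state at a time, then pause there for the remaining
  steps. The third hypothesis keeps the descent on one leg, where \<open>nxt\<close> subtracts
  one.\<close>

lemma descend_ge:
  assumes "y \<le> x" "x \<le> top_state" "x \<le> L \<or> L < y" "x - y \<le> t"
  shows "(1 / (8 * real L)) ^ t \<le> step_prob legs t x y"
  using assms
proof (induction t arbitrary: x)
  case 0
  then show ?case by simp
next
  case (Suc t)
  have "(1 / (8 * real L)) ^ Suc t \<le> tr x z * step_prob legs t z y"
    if "1 / (8 * real L) \<le> tr x z" "(1 / (8 * real L)) ^ t \<le> step_prob legs t z y" for z
    unfolding power_Suc using that Suc.prems tr_nonneg by (intro mult_mono) auto
  moreover have "tr x z * step_prob legs t z y \<le> step_prob legs (Suc t) x y" if "z \<le> top_state" for z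
    using step_Suc_ge[of x y z t] Suc.prems that by simp
  moreover have "\<exists>z \<le> top_state. 1 / (8 * real L) \<le> tr x z \<and> (1 / (8 * real L)) ^ t \<le> step_prob legs t z y"
  proof (cases "x = y")
    case True
    then show ?thesis using Suc.prems tr_self_ge[of x] Suc.IH[of x] by auto
  next
    case False
    then have "nxt x = x - 1" using Suc.prems by (auto simp: nxt_def)
    then show ?thesis
      using Suc.prems False tr_nxt_ge[of x] Suc.IH[of "x - 1"] by (intro exI[of _ "x - 1"]) auto
  qed
  ultimately show ?case by force
qed

text \<open>Forward steps have probability at least \<open>1 / (8 * real L)\<close>, so over the relevant times a state
  that is reachable by such steps carries far more mass than in equilibrium.\<close>

lemma dens_ge_1_reachable:
  assumes "0 < y" "y \<le> x" "x \<le> top_state" "x \<le> L \<or> L < y \<or> k = 2 \<and> rim < x"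
    and "3 * L \<le> t" "t \<le> 40 * L"
  shows "1 \<le> dens t x y"
proof -
  have "(1 / (8 * real L)) ^ t \<le> step_prob legs t x y"
  proof (cases "x \<le> L \<or> L < y")
    case True
    then show ?thesis using assms top_le by (intro descend_ge) auto
  next
    case False
    with assms have far: "k = 2" "rim < x" "y \<le> L" by auto
    have "target = L" unfolding target_def using far(1) by simp
    obtain t' where t': "t = Suc t'" "L \<le> t'" using assms(5) L_ge_2 by (cases t) auto
    have L_le: "L \<le> top_state" using top_ge by simp
    \<comment> \<open>One jump leads from the extension to the leaf \<open>L\<close>, from which the
      first leg is descended.\<close>
    have "(1 / (8 * real L)) ^ t \<le> tr x L * step_prob legs t' L y"
      unfolding t' power_Suc
      using tr_target_ge[OF far(2)] \<open>target = L\<close> far t' L_le tr_nonneg[OF assms(3)]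
      by (intro mult_mono descend_ge) auto
    also have "\<dots> \<le> step_prob legs t x y"
      unfolding t' using step_Suc_ge[of x y L t'] assms L_le by simp
    finally show ?thesis .
  qed
  then have "wt y \<le> step_prob legs t x y"
    using eta_le_power[OF assms(6)] wt_le_eta[OF assms(1)] by linarith
  also have "\<dots> \<le> step_prob legs t x y * (\<Sum>z\<le>top_state. wt z)"
    using wt_total_ge step_0_nonneg[of x y t] assms
      mult_left_mono[of 1 "\<Sum>z\<le>top_state. wt z" "step_prob legs t x y"] by simp
  finally show ?thesis using wt_pos[of y] by (simp add: dens_def)
qed

text \<open>Every state reaches the centre along \<open>nxt\<close>, and reversibility provides the
  way back.\<close>

lemma irreducible: "irreducible_chain legs"
  unfolding irreducible_chain_def
proof (intro ballI)
  have to_0: "\<exists>t. 0 < step_prob legs t x 0" if "x \<le> top_state" for x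
    using that
  proof (induction x rule: less_induct)
    case (less x)
    show ?case
    proof (cases "x = 0")
      case True
      then show ?thesis by (intro exI[of _ 0]) simp
    next
      case False
      then have n: "nxt x < x" by (simp add: nxt_less)
      with less obtain t where t: "0 < step_prob legs t (nxt x) 0" by fastforce
      have "0 < 1 / (8 * real L)" using L_ge_2 by simp
      also have "\<dots> \<le> tr x (nxt x)" using tr_nxt_ge[of x] False by simp
      finally have "0 < tr x (nxt x) * step_prob legs t (nxt x) 0" using t by simp
      also have "\<dots> \<le> step_prob legs (Suc t) x 0"
        using step_Suc_ge[of x 0 "nxt x" t] less.prems n by simp
      finally show ?thesis by blast
    qed
  qed
  fix x y assume xy: "x \<in> states legs" "y \<in> states legs"
  then obtain s t where st: "0 < step_prob legs s x 0" "0 < step_prob legs t y 0"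
    using to_0[of x] to_0[of y] by auto
  have "step_prob legs t 0 y = step_prob legs t y 0 * wt y"
    using step_from_centre[of y t] xy wt_pos[of y] by (simp add: field_simps)
  then have "0 < step_prob legs s x 0 * step_prob legs t 0 y"
    using st wt_pos[of y] by simp
  also have "\<dots> \<le> step_prob legs (s + t) x y" using xy by (intro step_add_ge) auto
  finally show "\<exists>t. 0 < step_prob legs t x y" by blast
qed

section \<open>Estimates on the relevant time windows\<close>

lemma exp_gap_mono:
  fixes \<delta> :: real
  assumes "L \<le> R"
  shows "exp (- (\<delta>\<^sup>2 / 8) * real R) \<le> exp (- (\<delta>\<^sup>2 / 8) * real L)"
  using assms by (simp add: mult_left_mono)

lemma at_centre_late:
  fixes \<delta> :: real
  assumes "0 < \<delta>" "\<delta> < 1" "x \<le> top_state" "dist0 x \<le> R" "L \<le> R"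
    and "4 * (1 + \<delta>) * R \<le> t" "t \<le> 40 * L"
  shows "1 - gap L \<delta> \<le> step_prob legs t x 0"
proof -
  have "1 - step_prob legs t x 0 \<le> profile (1 + \<delta>/2) t (dist0 x) + t * (top_state * eta)"
    using assms by (intro not_at_centre_le) auto
  also have "profile (1 + \<delta>/2) t (dist0 x) \<le> profile (1 + \<delta>/2) t R"
    using assms by (intro profile_mono) auto
  also have "\<dots> \<le> exp (- (\<delta>\<^sup>2 / 8) * R)"
    unfolding profile_def using assms by (intro profile_decay_late) auto
  finally show ?thesis
    using exp_gap_mono[OF assms(5), of \<delta>] error_le[OF assms(7)] unfolding gap_def by linarith
qed

lemma at_centre_early:
  fixes \<delta> :: real
  assumes "0 < \<delta>" "\<delta> < 1" "x \<le> top_state" "L \<le> dist0 x"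
    and "t \<le> 4 * (1 - \<delta>) * dist0 x" "t \<le> 40 * L"
  shows "step_prob legs t x 0 \<le> 1 - no_jump x + gap L \<delta>"
proof -
  have "step_prob legs t x 0
      \<le> 1 - no_jump x + profile (1 - \<delta>/2) t (dist0 x) + t * (top_state * eta)"
    using assms by (intro at_centre_le) auto
  also have "profile (1 - \<delta>/2) t (dist0 x) \<le> exp (- (\<delta>\<^sup>2 / 8) * dist0 x)"
    unfolding profile_def using assms by (intro profile_decay_early) auto
  finally show ?thesis
    using exp_gap_mono[OF assms(4), of \<delta>] error_le[OF assms(6)] unfolding gap_def by linarith
qed

text \<open>The route between the two leaves takes \<open>2 * L\<close> ordinary moves through the
  centre, hence time about \<open>8 * L\<close>; the factor \<open>1 + 1 / L\<close> bounds the
  normalising constant. For \<open>k = 2\<close> the state \<open>2 * L\<close> is the rim itself,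
  so no jump can shorten the route.\<close>

lemma leaf_dens_early:
  fixes \<delta> :: real
  assumes "0 < \<delta>" "\<delta> < 1" "t \<le> 8 * (1 - \<delta>) * L"
  shows "dens t (2 * L) L \<le> (1 - no_jump (2 * L) + gap L \<delta>) * (1 + 1 / L)"
proof -
  have d: "dist0 (2 * L) = L" using L_ge_2 by (simp add: dist0_def)
  have "8 * (1 - \<delta>) * L \<le> 8 * real L" using assms by (intro mult_right_mono) auto
  with assms(3) have "real t \<le> 8 * real L" by (rule order_trans)
  then have t: "t \<le> 40 * L" by linarith
  have "step_prob legs t (2 * L) L / wt L
      \<le> 1 - no_jump (2 * L) + profile (1 - \<delta>/2) t (dist0 (2 * L) + L) + t * (top_state * eta)"
    using assms L_ge_2 by (intro leaf_density_le) auto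
  also have "profile (1 - \<delta>/2) t (dist0 (2 * L) + L) \<le> exp (- (\<delta>\<^sup>2 / 8) * real (L + L))"
    unfolding profile_def d using assms by (intro profile_decay_early) (auto simp: algebra_simps)
  also have "\<dots> \<le> exp (- (\<delta>\<^sup>2 / 8) * real L)" by (rule exp_gap_mono) simp
  finally have *: "step_prob legs t (2 * L) L / wt L \<le> 1 - no_jump (2 * L) + gap L \<delta>"
    using error_le[OF t] unfolding gap_def by linarith
  have "dens t (2 * L) L = step_prob legs t (2 * L) L / wt L * (\<Sum>z\<le>top_state. wt z)"
    by (simp add: dens_def)
  also have "\<dots> \<le> (1 - no_jump (2 * L) + gap L \<delta>) * (1 + 1 / L)"
    using * wt_total_le wt_total_ge no_jump_bounds[of "2 * L"]
    by (intro mult_mono) (auto simp: gap_def)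
  finally show ?thesis .
qed

text \<open>A jump has rate \<open>1 / (4 * L)\<close>, so the probability of remaining beyond the
  rim until time \<open>4 * \<delta> * L\<close> is at most \<open>exp (- \<delta>)\<close>, up to
  upward moves.\<close>

lemma within_rim_ge:
  fixes \<delta> :: real
  assumes "x \<le> top_state" "4 * \<delta> * L \<le> s" "s \<le> 40 * L"
  shows "1 - exp (- \<delta>) - 1 / L \<le> (\<Sum>y\<le>rim. step_prob legs s x y)"
proof -
  let ?b = "1 - 1 / (4 * real L)"
  have b: "0 \<le> ?b" using L_ge_2 by (simp add: field_simps)
  have "(\<Sum>y\<in>{rim<..top_state}. step_prob legs s x y) \<le> ?b ^ s + s * (top_state * eta)"
    using beyond_rim_le[OF assms(1), of s] zero_le_power[OF b, of s]
    by (cases "rim < x") (simp_all del: zero_le_power)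
  moreover have "?b ^ s \<le> exp (- (1 / (4 * real L))) ^ s"
    using b exp_ge_add_one_self[of "- (1 / (4 * real L))"] by (intro power_mono) auto
  moreover have "exp (- (1 / (4 * real L))) ^ s \<le> exp (- \<delta>)"
    using assms(2) L_ge_2 by (simp add: exp_of_nat_mult[symmetric] field_simps)
  moreover have "(\<Sum>y\<le>top_state. step_prob legs s x y)
      = (\<Sum>y\<le>rim. step_prob legs s x y) + (\<Sum>y\<in>{rim<..top_state}. step_prob legs s x y)"
  proof -
    have "{..top_state} = {..rim} \<union> {rim<..top_state}" using rim_le(3) by auto
    moreover have "(\<Sum>y\<in>{..rim} \<union> {rim<..top_state}. step_prob legs s x y)
      = (\<Sum>y\<le>rim. step_prob legs s x y) + (\<Sum>y\<in>{rim<..top_state}. step_prob legs s x y)"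
      by (intro sum.union_disjoint) auto
    ultimately show ?thesis by simp
  qed
  ultimately show ?thesis
    using step_sum[of x s] assms(1) error_le[OF assms(3)] by simp
qed

text \<open>Raises \<open>1 - u \<ge> exp (- (2 * u))\<close>, valid for
  \<open>0 < u \<le> 1 / 2\<close>, to the power \<open>L\<close> at
  \<open>u = 1 / L\<close>.\<close>

lemma no_jump_top: "exp (- 2) \<le> no_jump top_state"
proof -
  define u where "u = 1 / real L"
  have u: "0 < u" "u \<le> 1 / 2" using L_ge_2 by (auto simp: u_def field_simps)
  have "exp (- (2 * u)) = 1 / exp (2 * u)" by (simp add: exp_minus field_simps)
  also have "\<dots> \<le> 1 / (1 + 2 * u)" using u exp_ge_add_one_self[of "2 * u"] by (intro frac_le) auto
  also have "\<dots> \<le> 1 - u"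
    using u mult_left_mono[of u "1 / 2" u] by (simp add: field_simps)
  finally have "exp (- (2 * u)) ^ L \<le> (1 - u) ^ L" by (intro power_mono) auto
  also have "exp (- (2 * u)) ^ L = exp (- 2)"
    using L_ge_2 by (simp add: exp_of_nat_mult[symmetric] u_def)
  also have "(1 - u) ^ L = no_jump top_state" by (simp add: no_jump_def top_rim u_def)
  finally show ?thesis .
qed

subsection \<open>Distances to equilibrium\<close>

lemma d_tv_late:
  fixes \<delta> :: real
  assumes "0 < \<delta>" "\<delta> < 1" "4 * (1 + \<delta>) * (k * L) \<le> t" "t \<le> 40 * L"
  shows "d_tv legs t \<le> gap L \<delta> + 1 / L"
proof -
  have "d_tv legs t \<le> gap L \<delta> + (1 - stationary legs 0)"
  proof (rule d_tv_le)
    fix x assume "x \<in> states legs"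
    then have x: "x \<le> top_state" by simp
    have "dist0 x \<le> k * L" "L \<le> k * L"
      using x k_cases by (auto simp: dist0_def top_state_def)
    then have "1 - gap L \<delta> \<le> step_prob legs t x 0"
      using assms x by (intro at_centre_late[where R = "k * L"]) auto
    then show "1 - step_prob legs t x 0 \<le> gap L \<delta>" by linarith
  qed auto
  then show ?thesis using stationary_0_ge by linarith
qed

lemma d_tv_early:
  fixes \<delta> :: real
  assumes "0 < \<delta>" "\<delta> < 1" "t \<le> 4 * (1 - \<delta>) * L"
  shows "1 - 1 / L - gap L \<delta> \<le> d_tv legs t"
proof -
  have d: "dist0 L = L" by (simp add: dist0_def)
  have L_le: "L \<le> top_state" using top_ge by simp
  have "4 * (1 - \<delta>) * L \<le> 4 * real L" using assms by (intro mult_right_mono) auto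
  with assms(3) have "real t \<le> 4 * real L" by (rule order_trans)
  then have "t \<le> 40 * L" by linarith
  then have "step_prob legs t L 0 \<le> gap L \<delta>"
    using at_centre_early[of \<delta> L t] assms L_le d rim_le by (simp add: no_jump_below)
  then show ?thesis using d_tv_ge[of 0 L t] stationary_0_ge L_le by simp
qed

lemma d_sep_early:
  fixes \<delta> :: real
  assumes "0 < \<delta>" "\<delta> < 1" "t \<le> 4 * (1 - \<delta>) * L"
  shows "1 - 2 * gap L \<delta> \<le> d_sep legs t"
proof -
  have d: "dist0 L = L" by (simp add: dist0_def)
  have L_le: "L \<le> top_state" using top_ge by simp
  have "4 * (1 - \<delta>) * L \<le> 4 * real L" using assms by (intro mult_right_mono) auto
  with assms(3) have "real t \<le> 4 * real L" by (rule order_trans)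
  then have "t \<le> 40 * L" by linarith
  then have "step_prob legs t L 0 \<le> gap L \<delta>"
    using at_centre_early[of \<delta> L t] assms L_le d rim_le by (simp add: no_jump_below)
  moreover have "(\<Sum>z\<le>top_state. wt z) \<le> 2"
  proof -
    have "1 / real L \<le> 1" using L_ge_2 by simp
    with wt_total_le show ?thesis by linarith
  qed
  ultimately have "dens t L 0 \<le> gap L \<delta> * 2"
    using wt_total_ge step_0_nonneg[OF L_le, of 0 t] unfolding dens_def
    by (simp add: mult_mono)
  then show ?thesis using d_sep_ge[of L 0 t] L_le by simp
qed

text \<open>Two states within distance \<open>L\<close> of the centre meet there after
  \<open>t\<close> steps each. States further out lie on the extension for \<open>k = 2\<close>;
  from there \<open>t + t\<close> steps suffice to reach the centre, and the nonzero states not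
  above them are reached by forward moves, with density at least 1.\<close>

lemma d_sep_late:
  fixes \<delta> :: real
  assumes "0 < \<delta>" "\<delta> < 1" "4 * (1 + \<delta>) * L \<le> t" "t \<le> 20 * L" "gap L \<delta> \<le> 1"
  shows "d_sep legs (t + t) \<le> 2 * gap L \<delta>"
proof (rule d_sep_le)
  let ?g = "gap L \<delta>"
  have g0: "0 \<le> ?g" by (simp add: gap_def)
  have sq: "1 - 2 * ?g \<le> (1 - ?g) * (1 - ?g)" by (simp add: algebra_simps)
  have t3: "3 * L \<le> t + t"
  proof -
    have "4 * real L \<le> 4 * (1 + \<delta>) * L" using assms by (intro mult_right_mono) auto
    from this assms(3) have "4 * real L \<le> t" by (rule order_trans)
    then show ?thesis by linarith
  qed
  have near: "1 - 2 * ?g \<le> dens (t + t) x y"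
    if xy: "x \<le> top_state" "y \<le> top_state" "dist0 x \<le> L" "dist0 y \<le> L" for x y
  proof -
    have "(1 - ?g) * (1 - ?g) \<le> step_prob legs t x 0 * step_prob legs t y 0"
      using assms xy step_0_nonneg[of x 0 t] by (intro mult_mono at_centre_late[where R = L]) auto
    also have "\<dots> \<le> dens (t + t) x y" using xy by (intro dens_through_point) auto
    finally show ?thesis using sq by linarith
  qed
  have far: "1 - 2 * ?g \<le> dens (t + t) x y"
    if xy: "y \<le> x" "x \<le> top_state" "L < dist0 x" for x y
  proof -
    have x: "k = 2" "rim < x" using xy k_cases L_ge_2 by (auto simp: dist0_def top_state_def rim_def split: if_splits)
    show ?thesis
    proof (cases "y = 0")
      case True
      have "dist0 x \<le> 2 * L" using xy top_le by (auto simp: dist0_def)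
      then have "1 - ?g \<le> step_prob legs (t + t) x 0"
        using assms xy by (intro at_centre_late[where R = "2 * L"]) auto
      also have "\<dots> \<le> dens (t + t) x 0" using xy by (intro step_le_dens) auto
      finally show ?thesis unfolding True using g0 by linarith
    next
      case False
      then have "1 \<le> dens (t + t) x y"
        using assms xy x t3 by (intro dens_ge_1_reachable) auto
      then show ?thesis using g0 by linarith
    qed
  qed
  fix x y assume "x \<in> states legs" "y \<in> states legs"
  then have xy: "x \<le> top_state" "y \<le> top_state" by auto
  show "1 - 2 * ?g \<le> dens (t + t) x y"
  proof (cases "dist0 x \<le> L \<and> dist0 y \<le> L")
    case True
    then show ?thesis using near xy by blast
  next
    case False
    \<comment> \<open>Only the states above \<open>2 * L\<close> are at distance more than
      \<open>L\<close>, so the larger state is a far one; by symmetry it may serve as the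
      start.\<close>
    then have "L < dist0 (max x y)" by (auto simp: dist0_def max_def split: if_splits)
    then show ?thesis
      using far[of y x] far[of x y] dens_sym[of x y "t + t"] xy
      by (cases "x \<le> y") (auto simp: max_def split: if_splits)
  qed
qed

text \<open>Each end gets \<open>s\<close> steps to come within the rim, that is, to the first leg
  or the centre; the two ends give the square. In between, \<open>t\<close> steps suffice, since any
  two states up to \<open>L\<close> lie on one line.\<close>

lemma d_sep_intermediate:
  fixes \<delta> :: real
  assumes "k = 1" "0 < \<delta>" "\<delta> < 1" "4 * (1 + \<delta>) * L \<le> t" "t \<le> 20 * L"
    and "4 * \<delta> * L \<le> s" "s \<le> 20 * L" "gap L \<delta> \<le> 1" "0 \<le> 1 - exp (- \<delta>) - 1 / L"
  shows "d_sep legs (s + (t + s)) \<le> 1 - (1 - exp (- \<delta>) - 1 / L)\<^sup>2 * (1 - gap L \<delta>)"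
proof (rule d_sep_le)
  define w where "w = 1 - exp (- \<delta>) - 1 / L"
  let ?g = "gap L \<delta>"
  have rim: "rim = L" unfolding rim_def using assms(1) by simp
  have subset: "{..rim} \<subseteq> {..top_state}" using rim_le by auto
  have w: "0 \<le> w" "0 \<le> 1 - ?g" using assms by (auto simp: w_def)
  have g0: "0 \<le> ?g" by (simp add: gap_def)
  have exits: "w \<le> (\<Sum>z\<le>rim. step_prob legs s x z)" if "x \<le> top_state" for x
    unfolding w_def using assms that by (intro within_rim_ge) auto
  have t3: "3 * L \<le> t"
  proof -
    have "4 * real L \<le> 4 * (1 + \<delta>) * L" using assms by (intro mult_right_mono) auto
    from this assms(4) have "4 * real L \<le> t" by (rule order_trans)
    then show ?thesis by linarith
  qed
  have centre: "1 - ?g \<le> dens t z 0" if "z \<le> L" for z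
  proof -
    have z: "z \<le> top_state" "dist0 z \<le> L" using that top_ge by (auto simp: dist0_def)
    have "1 - ?g \<le> step_prob legs t z 0"
      using assms z by (intro at_centre_late[where R = L]) auto
    also have "\<dots> \<le> dens t z 0" using z by (intro step_le_dens) auto
    finally show ?thesis .
  qed
  have ordered: "1 - ?g \<le> dens t z y" if "z \<le> L" "y \<le> z" for z y
  proof (cases "y = 0")
    case False
    then have "1 \<le> dens t z y"
      using that assms t3 top_ge by (intro dens_ge_1_reachable) auto
    then show ?thesis using g0 by linarith
  qed (use centre that in auto)
  have inner: "1 - ?g \<le> dens t z y" if "z \<le> L" "y \<le> L" for z y
    using ordered[of z y] ordered[of y z] dens_sym[of y z t] that top_ge
    by (cases "y \<le> z") auto
  have one: "w * (1 - ?g) \<le> dens (s + t) x y" if "x \<le> top_state" "y \<le> L" for x y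
  proof -
    have "w * (1 - ?g) \<le> (\<Sum>z\<le>rim. step_prob legs s x z) * (1 - ?g)"
      using exits[OF that(1)] w by (intro mult_right_mono)
    also have "\<dots> \<le> dens (s + t) x y"
      using that w inner top_ge subset by (intro dens_add_ge) (auto simp: rim)
    finally show ?thesis .
  qed
  fix x y assume "x \<in> states legs" "y \<in> states legs"
  then have xy: "x \<le> top_state" "y \<le> top_state" by auto
  have "w * (w * (1 - ?g)) \<le> (\<Sum>z\<le>rim. step_prob legs s x z) * (w * (1 - ?g))"
    using exits[OF xy(1)] w by (intro mult_right_mono) auto
  also have "\<dots> \<le> dens (s + (t + s)) x y"
  proof (intro dens_add_ge)
    show "w * (1 - ?g) \<le> dens (t + s) z y" if "z \<in> {..rim}" for z
      using one[of y z] dens_sym[of z y "t + s"] that xy top_ge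
      by (simp add: rim add.commute)
  qed (use xy w subset in auto)
  finally show "1 - (1 - (1 - exp (- \<delta>) - 1 / L)\<^sup>2 * (1 - ?g)) \<le> dens (s + (t + s)) x y"
    unfolding w_def by (simp add: power2_eq_square mult.assoc)
qed

text \<open>Every state within the rim is at distance at most \<open>L\<close> from the centre, so
  \<open>t\<close> steps suffice after the first \<open>s\<close> have led there.\<close>

lemma d_tv_intermediate:
  fixes \<delta> :: real
  assumes "0 < \<delta>" "\<delta> < 1" "4 * (1 + \<delta>) * L \<le> t" "t \<le> 20 * L"
    and "4 * \<delta> * L \<le> s" "s \<le> 20 * L" "gap L \<delta> \<le> 1"
  shows "d_tv legs (s + t) \<le> 1 - (1 - exp (- \<delta>) - 1 / L) * (1 - gap L \<delta>) + 1 / L"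
proof -
  define w where "w = 1 - exp (- \<delta>) - 1 / L"
  let ?g = "gap L \<delta>"
  have subset: "{..rim} \<subseteq> {..top_state}" using rim_le by auto
  have "d_tv legs (s + t) \<le> 1 - w * (1 - ?g) + (1 - stationary legs 0)"
  proof (rule d_tv_le)
    fix x assume "x \<in> states legs"
    then have x: "x \<le> top_state" by simp
    have "w * (1 - ?g) \<le> (\<Sum>z\<le>rim. step_prob legs s x z) * (1 - ?g)"
      unfolding w_def using assms x by (intro mult_right_mono within_rim_ge) auto
    also have "\<dots> \<le> (\<Sum>z\<le>rim. step_prob legs s x z * step_prob legs t z 0)"
      unfolding sum_distrib_right
    proof (intro sum_mono mult_left_mono)
      fix z assume "z \<in> {..rim}"
      then have z: "z \<le> top_state" "dist0 z \<le> L" using subset rim_le by (auto simp: dist0_def)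
      show "1 - ?g \<le> step_prob legs t z 0"
        using assms z by (intro at_centre_late[where R = L]) auto
      show "0 \<le> step_prob legs s x z" using x z by (intro step_0_nonneg)
    qed
    also have "\<dots> \<le> step_prob legs (s + t) x 0"
      using x subset by (subst step_add) (auto intro!: sum_mono2 mult_nonneg_nonneg step_0_nonneg)
    finally show "1 - step_prob legs (s + t) x 0 \<le> 1 - w * (1 - ?g)" by linarith
  qed auto
  then show ?thesis using stationary_0_ge unfolding w_def by linarith
qed

lemma d_sep_middle:
  fixes \<delta> :: real
  assumes "0 < \<delta>" "\<delta> < 1" "t \<le> 8 * (1 - \<delta>) * L"
  shows "1 - (1 - no_jump (2 * L) + gap L \<delta>) * (1 + 1 / L) \<le> d_sep legs t"
proof -
  have "1 - dens t (2 * L) L \<le> d_sep legs t" using top_ge by (intro d_sep_ge) auto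
  then show ?thesis using leaf_dens_early[OF assms] by linarith
qed

text \<open>The tip of the extension is at distance \<open>2 * L\<close>, and with probability at
  least \<open>exp (- 2)\<close> no jump shortens its way.\<close>

lemma d_tv_middle:
  fixes \<delta> :: real
  assumes "k = 2" "0 < \<delta>" "\<delta> < 1" "t \<le> 8 * (1 - \<delta>) * L"
  shows "exp (- 2) - 1 / L - gap L \<delta> \<le> d_tv legs t"
proof -
  have "top_state = 3 * L" unfolding top_state_def using assms(1) by simp
  then have d: "dist0 top_state = 2 * L" using L_ge_2 by (simp add: dist0_def)
  have "8 * (1 - \<delta>) * L \<le> 8 * real L" using assms by (intro mult_right_mono) auto
  with assms(4) have "real t \<le> 8 * real L" by (rule order_trans)
  then have "t \<le> 40 * L" by linarith
  then have "step_prob legs t top_state 0 \<le> 1 - no_jump top_state + gap L \<delta>"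
    using assms d by (intro at_centre_early) (auto simp: algebra_simps)
  moreover have "stationary legs 0 - step_prob legs t top_state 0 \<le> d_tv legs t"
    by (intro d_tv_ge) auto
  ultimately show ?thesis using no_jump_top stationary_0_ge by linarith
qed

end

section \<open>The two sequences\<close>

text \<open>The shift meets the requirement \<open>2 \<le> L\<close> for every
  \<open>n\<close>.\<close>

definition len :: "nat \<Rightarrow> nat" where "len n = n + 2"

lemma gap_tendsto_0: "0 < \<delta> \<Longrightarrow> (\<lambda>n. gap (len n) \<delta>) \<longlonglongrightarrow> 0"
  unfolding gap_def len_def by real_asymp

lemma inverse_tendsto_0: "(\<lambda>n. 1 / real (len n)) \<longlonglongrightarrow> 0"
  unfolding len_def by real_asymp

lemma len_pos: "0 < len n"
  by (simp add: len_def)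

lemma eventually_time_between:
  fixes a b :: real
  assumes "0 \<le> a" "a < b"
  shows "\<forall>\<^sub>F n in sequentially. \<exists>t. a * real (len n) \<le> real t \<and> real t \<le> b * real (len n)"
  using eventually_ge_at_top[of "nat \<lceil>1 / (b - a)\<rceil>"]
proof eventually_elim
  case (elim n)
  then have "1 / (b - a) \<le> real (len n)" unfolding len_def by linarith
  then have "1 \<le> (b - a) * real (len n)" using assms by (simp add: field_simps)
  then have "a * real (len n) + 1 \<le> b * real (len n)" by (simp add: left_diff_distrib)
  moreover have "0 \<le> a * real (len n)" using assms by simp
  ultimately show ?case
    by (intro exI[of _ "nat \<lceil>a * real (len n)\<rceil>"]) linarith
qed

definition leg_seq :: "nat \<Rightarrow> nat \<Rightarrow> nat chain" where
  "leg_seq k n = leg_chain.legs (len n) k"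

lemma leg_chain_seq: "k = 1 \<or> k = 2 \<Longrightarrow> leg_chain (len n) k"
  by (simp add: leg_chain_def len_def)

lemma leg_seq_lazy_reversible:
  assumes "k = 1 \<or> k = 2"
  shows "lazy_reversible_sequence (leg_seq k)"
  unfolding lazy_reversible_sequence_def leg_seq_def
proof
  fix n
  interpret leg_chain "len n" k using assms by (rule leg_chain_seq)
  show "finite_markov_chain legs \<and> irreducible_chain legs \<and> lazy_chain legs \<and> reversible_chain legs"
    using markov reversible lazy irreducible by blast
qed

lemma eventually_gap_le_1: "0 < \<delta> \<Longrightarrow> \<forall>\<^sub>F n in sequentially. gap (len n) \<delta> \<le> 1"
  using order_tendstoD(2)[OF gap_tendsto_0, of \<delta> 1] by (auto elim: eventually_mono)

definition exit_prob :: "nat \<Rightarrow> real \<Rightarrow> real" where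
  "exit_prob L \<delta> = 1 - exp (- \<delta>) - 1 / L"

lemma exit_prob_tendsto: "(\<lambda>n. exit_prob (len n) \<delta>) \<longlonglongrightarrow> 1 - exp (- \<delta>)"
  unfolding exit_prob_def by (rule tendsto_eq_intros inverse_tendsto_0 refl | simp)+

text \<open>Each of \<open>s\<close>, \<open>t\<close>, \<open>s\<close> uses up at most
  \<open>\<delta>/4\<close> of the allowance \<open>\<delta>\<close>. The first sequence runs for
  \<open>s + (t + s)\<close>, the second for \<open>s + t\<close>.\<close>

lemma seq_times:
  fixes \<delta> :: real
  assumes \<delta>: "0 < \<delta>" "\<delta> < 1"
  shows "\<forall>\<^sub>F n in sequentially. \<exists>s t. 4 * (1 + \<delta>/8) * real (len n) \<le> real t \<and> t \<le> 20 * len n \<and>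
     4 * (\<delta>/8) * real (len n) \<le> real s \<and> s \<le> 20 * len n \<and>
     real (s + (t + s)) \<le> 4 * (1 + \<delta>) * real (len n)"
proof -
  have "\<forall>\<^sub>F n in sequentially. \<exists>t. 4 * (1 + \<delta>/8) * real (len n) \<le> real t \<and>
      real t \<le> 4 * (1 + \<delta>/4) * real (len n)"
    using \<delta> by (intro eventually_time_between) auto
  moreover have "\<forall>\<^sub>F n in sequentially. \<exists>s. 4 * (\<delta>/8) * real (len n) \<le> real s \<and>
      real s \<le> 4 * (\<delta>/4) * real (len n)"
    using \<delta> by (intro eventually_time_between) auto
  ultimately show ?thesis
  proof eventually_elim
    case (elim n)
    then obtain s t where st: "4 * (1 + \<delta>/8) * real (len n) \<le> real t"
      "real t \<le> 4 * (1 + \<delta>/4) * real (len n)"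
      "4 * (\<delta>/8) * real (len n) \<le> real s" "real s \<le> 4 * (\<delta>/4) * real (len n)" by blast
    have "real (s + (t + s))
        \<le> 4 * (\<delta>/4) * real (len n) + (4 * (1 + \<delta>/4) * real (len n) + 4 * (\<delta>/4) * real (len n))"
      unfolding of_nat_add using st by (intro add_mono) auto
    also have "\<dots> = 4 * (1 + 3 * \<delta> / 4) * real (len n)" by (simp add: algebra_simps)
    also have "\<dots> \<le> 4 * (1 + \<delta>) * real (len n)" using \<delta> by (intro mult_right_mono) auto
    finally have total: "real (s + (t + s)) \<le> 4 * (1 + \<delta>) * real (len n)" .
    also have "\<dots> \<le> 4 * 2 * real (len n)" using \<delta> by (intro mult_mono) auto
    finally have "s \<le> 20 * len n" "t \<le> 20 * len n" by linarith+
    with st total show ?case by blast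
  qed
qed

section \<open>Distance bounds along the sequences\<close>

context
  fixes k :: nat and \<delta> :: real
  assumes k: "k = 1 \<or> k = 2" and \<delta>: "0 < \<delta>" "\<delta> < 1"
begin

lemma seq_d_tv_late:
  "\<forall>\<^sub>F n in sequentially. \<exists>t. real t \<le> 4 * (1 + \<delta>) * (k * real (len n)) \<and>
     d_tv (leg_seq k n) t \<le> gap (len n) (\<delta>/2) + 1 / real (len n)"
proof -
  have "4 * (1 + \<delta>/2) * k < 4 * (1 + \<delta>) * k" using \<delta> k by auto
  then have "\<forall>\<^sub>F n in sequentially. \<exists>t. 4 * (1 + \<delta>/2) * k * real (len n) \<le> real t \<and>
      real t \<le> 4 * (1 + \<delta>) * k * real (len n)"
    using \<delta> by (intro eventually_time_between) auto
  then show ?thesis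
  proof eventually_elim
    case (elim n)
    interpret leg_chain "len n" k using k by (rule leg_chain_seq)
    from elim obtain t where t: "4 * (1 + \<delta>/2) * k * real (len n) \<le> real t"
      "real t \<le> 4 * (1 + \<delta>) * k * real (len n)" by blast
    have "4 * (1 + \<delta>) * k * real (len n) \<le> 4 * 2 * 2 * real (len n)"
      using \<delta> k by (intro mult_mono mult_right_mono) auto
    with t(2) have "t \<le> 40 * len n" by linarith
    with t \<delta> have "d_tv legs t \<le> gap (len n) (\<delta>/2) + 1 / real (len n)"
      by (intro d_tv_late) (auto simp: mult.assoc)
    with t(2) show ?case by (auto simp: leg_seq_def mult.assoc)
  qed
qed

lemma seq_d_sep_late:
  "\<forall>\<^sub>F n in sequentially. \<exists>t. real t \<le> 8 * (1 + \<delta>) * real (len n) \<and>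
     d_sep (leg_seq k n) t \<le> 2 * gap (len n) (\<delta>/2)"
proof -
  have "\<forall>\<^sub>F n in sequentially. \<exists>t. 4 * (1 + \<delta>/2) * real (len n) \<le> real t \<and>
      real t \<le> 4 * (1 + \<delta>) * real (len n)"
    using \<delta> by (intro eventually_time_between) auto
  moreover have "\<forall>\<^sub>F n in sequentially. gap (len n) (\<delta>/2) \<le> 1"
    using \<delta> by (intro eventually_gap_le_1) simp
  ultimately show ?thesis
  proof eventually_elim
    case (elim n)
    interpret leg_chain "len n" k using k by (rule leg_chain_seq)
    from elim obtain t where t: "4 * (1 + \<delta>/2) * real (len n) \<le> real t"
      "real t \<le> 4 * (1 + \<delta>) * real (len n)" by blast
    have "4 * (1 + \<delta>) * real (len n) \<le> 4 * 2 * real (len n)"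
      using \<delta> by (intro mult_mono) auto
    with t(2) have "t \<le> 20 * len n" by linarith
    with t \<delta> elim have "d_sep legs (t + t) \<le> 2 * gap (len n) (\<delta>/2)"
      by (intro d_sep_late) auto
    moreover have "real (t + t) \<le> 8 * (1 + \<delta>) * real (len n)"
    proof -
      have "real (t + t) \<le> 2 * (4 * (1 + \<delta>) * real (len n))" using t(2) by simp
      then show ?thesis by (simp add: algebra_simps)
    qed
    ultimately show ?case unfolding leg_seq_def by blast
  qed
qed

lemma seq_d_tv_early:
  "\<forall>\<^sub>F n in sequentially. \<forall>t. real t \<le> 4 * (1 - \<delta>) * real (len n) \<longrightarrow>
     1 - 1 / real (len n) - gap (len n) \<delta> \<le> d_tv (leg_seq k n) t"
  unfolding leg_seq_def using leg_chain.d_tv_early[OF leg_chain_seq[OF k] \<delta>] by simp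

lemma seq_d_sep_early:
  "\<forall>\<^sub>F n in sequentially. \<forall>t. real t \<le> 4 * (1 - \<delta>) * real (len n) \<longrightarrow>
     1 - 2 * gap (len n) \<delta> \<le> d_sep (leg_seq k n) t"
  unfolding leg_seq_def using leg_chain.d_sep_early[OF leg_chain_seq[OF k] \<delta>] by simp

end

lemma tv_cutoff_sep_pre_cutoff:
  "cutoff t_mix (leg_seq 1)" "pre_cutoff t_sep (leg_seq 1)" "\<not> cutoff t_sep (leg_seq 1)"
  "pre_cutoff_ratio t_sep (leg_seq 1) = 2"
proof -
  interpret tv: distance_profile t_mix d_tv "leg_seq 1" "\<lambda>n. 4 * real (len n)"
    by unfold_locales (auto simp: t_mix_def len_pos)
  \<comment> \<open>Separation is measured in the unit of total variation, so that its window is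
    asymptotically from 1 to 2.\<close>
  interpret sep: distance_profile t_sep d_sep "leg_seq 1" "\<lambda>n. 4 * real (len n)"
    by unfold_locales (auto simp: t_sep_def len_pos)
  have [simp]: "(1::nat) = 1 \<or> (1::nat) = 2" by simp
  show "cutoff t_mix (leg_seq 1)"
  proof (rule tv.cutoffI)
    fix \<delta> \<epsilon> :: real assume *: "0 < \<delta>" "\<delta> < 1" "0 < \<epsilon>"
    have "(\<lambda>n. gap (len n) (\<delta>/2) + 1 / real (len n)) \<longlonglongrightarrow> 0 + 0"
      using * by (intro tendsto_add gap_tendsto_0 inverse_tendsto_0) auto
    with * show "tv.below_at (1 + \<delta>) \<epsilon>"
      using seq_d_tv_late[of 1 \<delta>] by (intro tv.below_atI) (auto simp: algebra_simps)
    have "(\<lambda>n. 1 - 1 / real (len n) - gap (len n) \<delta>) \<longlonglongrightarrow> 1 - 0 - 0"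
      using * by (intro tendsto_diff gap_tendsto_0 inverse_tendsto_0 tendsto_const)
    with * show "tv.above_until (1 - \<delta>) (1 - \<epsilon>)"
      using seq_d_tv_early[of 1 \<delta>] by (intro tv.above_untilI) (auto simp: algebra_simps)
  qed
  have below: "sep.below_at (2 + \<delta>) \<epsilon>" if "0 < \<delta>" "\<delta> < 1" "0 < \<epsilon>" for \<delta> \<epsilon>
  proof -
    have "(\<lambda>n. 2 * gap (len n) (\<delta>/2/2)) \<longlonglongrightarrow> 2 * 0"
      using that by (intro tendsto_mult_left gap_tendsto_0) auto
    from sep.below_atI[OF _ this] show ?thesis
      using that seq_d_sep_late[of 1 "\<delta>/2"] by (simp add: algebra_simps)
  qed
  have above: "sep.above_until (1 - \<delta>) (1 - \<epsilon>)" if "0 < \<delta>" "\<delta> < 1" "0 < \<epsilon>" for \<delta> \<epsilon>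
  proof -
    have "(\<lambda>n. 1 - 2 * gap (len n) \<delta>) \<longlonglongrightarrow> 1 - 2 * 0"
      using that by (intro tendsto_diff tendsto_mult_left gap_tendsto_0 tendsto_const)
    then show ?thesis
      using that seq_d_sep_early[of 1 \<delta>] by (intro sep.above_untilI) (auto simp: algebra_simps)
  qed
  have early: "\<exists>\<epsilon>>0. sep.below_at (1 + \<delta>) (1 - \<epsilon>)" if \<delta>: "0 < \<delta>" "\<delta> < 1" for \<delta>
  proof -
    define c where "c = 1 - exp (- (\<delta>/8))"
    have c: "0 < c" using \<delta> by (simp add: c_def)
    have lim: "(\<lambda>n. exit_prob (len n) (\<delta>/8)) \<longlonglongrightarrow> c"
      unfolding c_def by (rule exit_prob_tendsto)
    have "\<forall>\<^sub>F n in sequentially. gap (len n) (\<delta>/8) \<le> 1"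
      using \<delta> by (intro eventually_gap_le_1) simp
    with seq_times[OF \<delta>] order_tendstoD(1)[OF lim c]
    have "\<forall>\<^sub>F n in sequentially. \<exists>t. real t \<le> (1 + \<delta>) * (4 * real (len n)) \<and>
       d_sep (leg_seq 1 n) t \<le> 1 - (exit_prob (len n) (\<delta>/8))\<^sup>2 * (1 - gap (len n) (\<delta>/8))"
    proof eventually_elim
      case (elim n)
      interpret leg_chain "len n" 1 by (rule leg_chain_seq) simp
      from elim obtain s t where "4 * (1 + \<delta>/8) * real (len n) \<le> real t" "t \<le> 20 * len n"
        "4 * (\<delta>/8) * real (len n) \<le> real s" "s \<le> 20 * len n"
        and total: "real (s + (t + s)) \<le> 4 * (1 + \<delta>) * real (len n)" by blast
      then have "d_sep legs (s + (t + s))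
          \<le> 1 - (exit_prob (len n) (\<delta>/8))\<^sup>2 * (1 - gap (len n) (\<delta>/8))"
        unfolding exit_prob_def using \<delta> elim
        by (intro d_sep_intermediate) (auto simp: exit_prob_def)
      moreover have "real (s + (t + s)) \<le> (1 + \<delta>) * (4 * real (len n))"
        using total by (simp add: algebra_simps)
      ultimately show ?case unfolding leg_seq_def by blast
    qed
    moreover have "(\<lambda>n. 1 - (exit_prob (len n) (\<delta>/8))\<^sup>2 * (1 - gap (len n) (\<delta>/8)))
        \<longlonglongrightarrow> 1 - c\<^sup>2 * (1 - 0)"
      using \<delta> by (intro tendsto_diff tendsto_mult tendsto_power lim gap_tendsto_0 tendsto_const) simp
    \<comment> \<open>The limit is \<open>1 - c\<^sup>2\<close>; halving \<open>c\<^sup>2\<close>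
      makes the comparison strict.\<close>
    ultimately have "sep.below_at (1 + \<delta>) (1 - c\<^sup>2 / 2)"
      by (rule sep.below_atI) (use c in simp)
    with c show ?thesis by (intro exI[of _ "c\<^sup>2 / 2"]) simp
  qed
  \<comment> \<open>The lower bound tends to \<open>exp (- 2)\<close>, coming from
    \<open>no_jump_top\<close>; half of it is a strictly smaller level that does not depend on
    \<open>\<delta>\<close>.\<close>
  have late: "sep.above_until (2 - \<delta>) (exp (- 2) / 2)" if \<delta>: "0 < \<delta>" "\<delta> < 1" for \<delta>
  proof (rule sep.above_untilI)
    let ?f = "\<lambda>n. 1 - (1 - exp (- 2) + gap (len n) (\<delta>/2)) * (1 + 1 / real (len n))"
    show "\<forall>\<^sub>F n in sequentially. \<forall>t. real t \<le> (2 - \<delta>) * (4 * real (len n)) \<longrightarrow>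
        ?f n \<le> d_sep (leg_seq 1 n) t"
    proof (intro always_eventually allI impI)
      fix n t assume t: "real t \<le> (2 - \<delta>) * (4 * real (len n))"
      interpret leg_chain "len n" 1 by (rule leg_chain_seq) simp
      have "real t \<le> 8 * (1 - \<delta>/2) * real (len n)" using t by (simp add: algebra_simps)
      then have "1 - (1 - no_jump (2 * len n) + gap (len n) (\<delta>/2)) * (1 + 1 / real (len n))
          \<le> d_sep legs t"
        using \<delta> by (intro d_sep_middle) auto
      moreover have "top_state = 2 * len n" unfolding top_state_def by simp
      then have "exp (- 2) \<le> no_jump (2 * len n)" using no_jump_top by simp
      then have "(1 - no_jump (2 * len n) + gap (len n) (\<delta>/2)) * (1 + 1 / real (len n))
          \<le> (1 - exp (- 2) + gap (len n) (\<delta>/2)) * (1 + 1 / real (len n))"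
        by (intro mult_right_mono) auto
      ultimately show "?f n \<le> d_sep (leg_seq 1 n) t" unfolding leg_seq_def by linarith
    qed
    show "?f \<longlonglongrightarrow> 1 - (1 - exp (- 2) + 0) * (1 + 0)"
      using \<delta> by (intro tendsto_diff tendsto_mult tendsto_add gap_tendsto_0 inverse_tendsto_0
          tendsto_const) simp
  qed simp
  have half: "0 < exp (- 2 :: real) / 2" "exp (- 2 :: real) / 2 < 1 / 2" by auto
  show "pre_cutoff_ratio t_sep (leg_seq 1) = 2" "pre_cutoff t_sep (leg_seq 1)"
    "\<not> cutoff t_sep (leg_seq 1)"
    using sep.pre_cutoff_ratio_2[OF below above early late half] by auto
qed

lemma sep_cutoff_tv_pre_cutoff:
  "cutoff t_sep (leg_seq 2)" "pre_cutoff t_mix (leg_seq 2)" "\<not> cutoff t_mix (leg_seq 2)"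
  "pre_cutoff_ratio t_mix (leg_seq 2) = 2"
proof -
  \<comment> \<open>Here separation has its cutoff at twice the travel time of a plain leg, which is
    therefore its unit.\<close>
  interpret sep: distance_profile t_sep d_sep "leg_seq 2" "\<lambda>n. 8 * real (len n)"
    by unfold_locales (auto simp: t_sep_def len_pos)
  interpret tv: distance_profile t_mix d_tv "leg_seq 2" "\<lambda>n. 4 * real (len n)"
    by unfold_locales (auto simp: t_mix_def len_pos)
  show "cutoff t_sep (leg_seq 2)"
  proof (rule sep.cutoffI)
    fix \<delta> \<epsilon> :: real assume *: "0 < \<delta>" "\<delta> < 1" "0 < \<epsilon>"
    have lim: "(\<lambda>n. 2 * gap (len n) (\<delta>/2)) \<longlonglongrightarrow> 2 * 0"
      using * by (intro tendsto_mult_left gap_tendsto_0) auto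
    show "sep.below_at (1 + \<delta>) \<epsilon>"
      using * seq_d_sep_late[of 2 \<delta>]
      by (intro sep.below_atI[OF _ lim]) (simp_all add: algebra_simps)
    show "sep.above_until (1 - \<delta>) (1 - \<epsilon>)"
    proof (rule sep.above_untilI)
      let ?f = "\<lambda>n. 1 - gap (len n) \<delta> * (1 + 1 / real (len n))"
      show "\<forall>\<^sub>F n in sequentially. \<forall>t. real t \<le> (1 - \<delta>) * (8 * real (len n)) \<longrightarrow>
          ?f n \<le> d_sep (leg_seq 2 n) t"
      proof (intro always_eventually allI impI)
        fix n t assume t: "real t \<le> (1 - \<delta>) * (8 * real (len n))"
        interpret leg_chain "len n" 2 by (rule leg_chain_seq) simp
        \<comment> \<open>The leaf \<open>2 * L\<close> is not beyond the rim, so the jump term in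
          \<open>d_sep_middle\<close> vanishes.\<close>
        have "rim = 2 * len n" unfolding rim_def by simp
        then have "no_jump (2 * len n) = 1" by (simp add: no_jump_below)
        then show "?f n \<le> d_sep (leg_seq 2 n) t"
          using d_sep_middle[of \<delta> t] * t by (simp add: leg_seq_def algebra_simps)
      qed
      show "?f \<longlonglongrightarrow> 1 - 0 * (1 + 0)"
        using * by (intro tendsto_diff tendsto_mult tendsto_add gap_tendsto_0 inverse_tendsto_0
            tendsto_const)
    qed (use * in simp)
  qed
  have below: "tv.below_at (2 + \<delta>) \<epsilon>" if "0 < \<delta>" "\<delta> < 1" "0 < \<epsilon>" for \<delta> \<epsilon>
  proof -
    have "(\<lambda>n. gap (len n) (\<delta>/2/2) + 1 / real (len n)) \<longlonglongrightarrow> 0 + 0"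
      using that by (intro tendsto_add gap_tendsto_0 inverse_tendsto_0) auto
    from tv.below_atI[OF _ this] show ?thesis
      using that seq_d_tv_late[of 2 "\<delta>/2"] by (simp add: algebra_simps)
  qed
  have above: "tv.above_until (1 - \<delta>) (1 - \<epsilon>)" if "0 < \<delta>" "\<delta> < 1" "0 < \<epsilon>" for \<delta> \<epsilon>
  proof -
    have "(\<lambda>n. 1 - 1 / real (len n) - gap (len n) \<delta>) \<longlonglongrightarrow> 1 - 0 - 0"
      using that by (intro tendsto_diff gap_tendsto_0 inverse_tendsto_0 tendsto_const)
    then show ?thesis
      using that seq_d_tv_early[of 2 \<delta>] by (intro tv.above_untilI) (auto simp: algebra_simps)
  qed
  have early: "\<exists>\<epsilon>>0. tv.below_at (1 + \<delta>) (1 - \<epsilon>)" if \<delta>: "0 < \<delta>" "\<delta> < 1" for \<delta>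
  proof -
    define c where "c = 1 - exp (- (\<delta>/8))"
    have c: "0 < c" using \<delta> by (simp add: c_def)
    have lim: "(\<lambda>n. exit_prob (len n) (\<delta>/8)) \<longlonglongrightarrow> c"
      unfolding c_def by (rule exit_prob_tendsto)
    have "\<forall>\<^sub>F n in sequentially. gap (len n) (\<delta>/8) \<le> 1"
      using \<delta> by (intro eventually_gap_le_1) simp
    with seq_times[OF \<delta>]
    have "\<forall>\<^sub>F n in sequentially. \<exists>t. real t \<le> (1 + \<delta>) * (4 * real (len n)) \<and>
       d_tv (leg_seq 2 n) t
         \<le> 1 - exit_prob (len n) (\<delta>/8) * (1 - gap (len n) (\<delta>/8)) + 1 / real (len n)"
    proof eventually_elim
      case (elim n)
      interpret leg_chain "len n" 2 by (rule leg_chain_seq) simp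
      from elim obtain s t where "4 * (1 + \<delta>/8) * real (len n) \<le> real t" "t \<le> 20 * len n"
        "4 * (\<delta>/8) * real (len n) \<le> real s" "s \<le> 20 * len n"
        and total: "real (s + (t + s)) \<le> 4 * (1 + \<delta>) * real (len n)" by blast
      then have "d_tv legs (s + t)
          \<le> 1 - exit_prob (len n) (\<delta>/8) * (1 - gap (len n) (\<delta>/8)) + 1 / real (len n)"
        unfolding exit_prob_def using \<delta> elim by (intro d_tv_intermediate) auto
      moreover have "real (s + t) \<le> (1 + \<delta>) * (4 * real (len n))"
      proof -
        have "real (s + t) \<le> real (s + (t + s))" by simp
        also note total
        finally show ?thesis by (simp add: algebra_simps)
      qed
      ultimately show ?case unfolding leg_seq_def by blast
    qed
    moreover have "(\<lambda>n. 1 - exit_prob (len n) (\<delta>/8) * (1 - gap (len n) (\<delta>/8)) + 1 / real (len n))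
        \<longlonglongrightarrow> 1 - c * (1 - 0) + 0"
      using \<delta> by (intro tendsto_diff tendsto_mult tendsto_add lim gap_tendsto_0
          inverse_tendsto_0 tendsto_const) simp
    ultimately have "tv.below_at (1 + \<delta>) (1 - c / 2)"
      by (rule tv.below_atI) (use c in simp)
    with c show ?thesis by (intro exI[of _ "c / 2"]) simp
  qed
  have late: "tv.above_until (2 - \<delta>) (exp (- 2) / 2)" if \<delta>: "0 < \<delta>" "\<delta> < 1" for \<delta>
  proof (rule tv.above_untilI)
    let ?f = "\<lambda>n. exp (- 2) - 1 / real (len n) - gap (len n) (\<delta>/2)"
    show "\<forall>\<^sub>F n in sequentially. \<forall>t. real t \<le> (2 - \<delta>) * (4 * real (len n)) \<longrightarrow>
        ?f n \<le> d_tv (leg_seq 2 n) t"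
    proof (intro always_eventually allI impI)
      fix n t assume t: "real t \<le> (2 - \<delta>) * (4 * real (len n))"
      interpret leg_chain "len n" 2 by (rule leg_chain_seq) simp
      have "real t \<le> 8 * (1 - \<delta>/2) * real (len n)" using t by (simp add: algebra_simps)
      then show "?f n \<le> d_tv (leg_seq 2 n) t"
        unfolding leg_seq_def using \<delta> by (intro d_tv_middle) auto
    qed
    show "?f \<longlonglongrightarrow> exp (- 2) - 0 - 0"
      using \<delta> by (intro tendsto_diff gap_tendsto_0 inverse_tendsto_0 tendsto_const) simp
  qed simp
  have half: "0 < exp (- 2 :: real) / 2" "exp (- 2 :: real) / 2 < 1 / 2" by auto
  show "pre_cutoff_ratio t_mix (leg_seq 2) = 2" "pre_cutoff t_mix (leg_seq 2)"
    "\<not> cutoff t_mix (leg_seq 2)"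
    using tv.pre_cutoff_ratio_2[OF below above early late half] by auto
qed

theorem mainTheorem2:
  shows "(\<exists>C :: nat \<Rightarrow> nat chain.
            lazy_reversible_sequence C \<and> cutoff t_mix C \<and>
            pre_cutoff t_sep C \<and> \<not> cutoff t_sep C \<and> pre_cutoff_ratio t_sep C = 2)
       \<and> (\<exists>C :: nat \<Rightarrow> nat chain.
            lazy_reversible_sequence C \<and> cutoff t_sep C \<and>
            pre_cutoff t_mix C \<and> \<not> cutoff t_mix C \<and> pre_cutoff_ratio t_mix C = 2)"
  using leg_seq_lazy_reversible[of 1] leg_seq_lazy_reversible[of 2]
    tv_cutoff_sep_pre_cutoff sep_cutoff_tv_pre_cutoff by blast

end
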